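(* Let $p\ge 5$ be a prime and let $r,s,n$ be positive integers with $r\ge 2$. Then \[ D_{np}^{(r,s)}\equiv D_n^{(r,s)}+p^3B_{p-3}\,\mathcal{D}^{(r,s)}_n\pmod{p^4}, \] where $\mathcal{D}^{(r,s)}_n$ (independent of $p$) is given as follows. For $(r,s)=(2,1)$: \[ \mathcal{D}^{(2,1)}_n=8\sum_{k=0}^{n-1}\binom{n}{k}^2\binom{2k}{k}\binom{2n-2k-2}{n-k-1}n(n-k)^2-\frac{1}{3}\sum_{k=0}^n\binom{n}{k}^2\binom{2k}{k}\binom{2n-2k}{n-k}\bigl(2nk(n-k)+2k^3+2(n-k)^3\bigr), \] and for $r+s\ge 4$: \[ \mathcal{D}^{(r,s)}_n=-\frac{1}{3}\sum_{k=0}^n\binom{n}{k}^r\left(\binom{2k}{k}\binom{2n-2k}{n-k}\right)^s\bigl(rnk(n-k)+2sk^3+2s(n-k)^3\bigr). \]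
   Context: For $n\in\mathbb{N}$ and positive integers $r,s$, define $D_n^{(r,s)}=\sum_{k=0}^n\binom{n}{k}^r\left(\binom{2k}{k}\binom{2n-2k}{n-k}\right)^s$ (so $D_n^{(2,1)}$ are the Domb numbers). The Bernoulli numbers $B_m$ are defined by $\frac{z}{e^z-1}=\sum_{m\ge0}B_m\frac{z^m}{m!}$. For rationals $a,b$, $a\equiv b\pmod{p^m}$ means $(a-b)/p^m$ is a rational number whose denominator is not divisible by $p$. *)

theory Defs
  imports Main "HOL-Computational_Algebra.Formal_Power_Series"
begin

text \<open>Bernoulli numbers via the exponential generating function z/(e^z-1):
  z/(e^z-1) is the inverse of the power series (e^z-1)/z = sum z^n/(n+1)!.\<close>
definition bernoulli :: "nat \<Rightarrow> rat" where
  "bernoulli m = fact m * fps_nth (inverse (Abs_fps (\<lambda>n. 1 / fact (n + 1)) :: rat fps)) m"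

definition rat_cong :: "rat \<Rightarrow> rat \<Rightarrow> nat \<Rightarrow> nat \<Rightarrow> bool" where
  "rat_cong a b p m \<longleftrightarrow> \<not> (int p dvd snd (quotient_of ((a - b) / of_nat p ^ m)))"

definition D :: "nat \<Rightarrow> nat \<Rightarrow> nat \<Rightarrow> nat" where
  "D r s n = (\<Sum>k=0..n. (n choose k) ^ r * ((2*k choose k) * (2*n - 2*k choose (n - k))) ^ s)"

definition calD :: "nat \<Rightarrow> nat \<Rightarrow> nat \<Rightarrow> rat" where
  "calD r s n =
    (if r = 2 \<and> s = 1 then
       8 * (\<Sum>k=0..n-1. of_nat ((n choose k)^2 * (2*k choose k) * (2*n-2*k-2 choose (n-k-1))
                                * n * (n-k)^2))
       - 1/3 * (\<Sum>k=0..n. of_nat ((n choose k)^2 * (2*k choose k) * (2*n-2*k choose (n-k))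
                                * (2*n*k*(n-k) + 2*k^3 + 2*(n-k)^3)))
     else
       - 1/3 * (\<Sum>k=0..n. of_nat ((n choose k)^r * ((2*k choose k) * (2*n-2*k choose (n-k)))^s
                                * (r*n*k*(n-k) + 2*s*k^3 + 2*s*(n-k)^3))))"

end

theory Submission
  imports Defs "HOL-Number_Theory.Residues"
begin

text \<open>
  Split the sum for index \<open>n p\<close> according to whether \<open>p\<close> divides \<open>k\<close>. For \<open>k = j p\<close> every binomial
  coefficient satisfies \<open>binom(n p, j p) \<equiv> binom(n, j) (1 - p^3 B_{p-3} n j (n - j) / 3)\<close> modulo \<open>p^4\<close>:
  pairing \<open>i\<close> with \<open>p - i\<close> in the product of the \<open>N p + i\<close> over \<open>0 < i < p\<close> reduces this to the sum of
  \<open>1 / (i (p - i))\<close> over \<open>i \<le> (p - 1) / 2\<close> modulo \<open>p^2\<close>. For \<open>p\<close> not dividing \<open>k\<close> the summand is divisible by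
  \<open>p^(r + s)\<close>, so it only matters for \<open>r = 2\<close>, \<open>s = 1\<close>, where it is a multiple of \<open>p^3 / i^3\<close> with \<open>i\<close> the
  residue of \<open>k\<close>.

  Both contributions thus rest on \<open>T\<close>, the sum of \<open>1 / i^3\<close> over \<open>i \<le> (p - 1) / 2\<close>, modulo \<open>p\<close>. Writing a sum of
  \<open>f i\<close> over \<open>0 < i < p\<close> once by pairing \<open>i\<close> with \<open>p - i\<close> and once by pairing \<open>2 i\<close> with \<open>p - 2 i\<close>
  eliminates the half-range sum of \<open>f\<close>. With \<open>f i = i^(p-3)\<close>, whose full sum is \<open>p B_{p-3}\<close> modulo \<open>p^2\<close>,
  this gives \<open>T \<equiv> - 2 B_{p-3}\<close>; with \<open>f i = 1 / i^2\<close> it expresses the sum needed for the binomial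
  coefficients through \<open>T\<close>.
\<close>

section \<open>Congruences between rationals modulo prime powers\<close>

locale rat_localization =
  fixes p :: nat
  assumes prime_p: "prime p"
begin

text \<open>The localization of the integers at \<open>p\<close>, inside \<open>rat\<close>. The
  reduced denominator from \<open>quotient_of\<close> is used because \<open>rat_cong\<close> is
  phrased with it, so the two match by unfolding.\<close>

definition Zp :: "rat set" where
  "Zp = {x. \<not> int p dvd snd (quotient_of x)}"

definition Up :: "rat set" where
  "Up = {x \<in> Zp. x \<noteq> 0 \<and> inverse x \<in> Zp}"

definition cg :: "nat \<Rightarrow> rat \<Rightarrow> rat \<Rightarrow> bool" where
  "cg m x y \<longleftrightarrow> rat_cong x y p m"

lemma p_pos [simp]: "0 < p" "p \<noteq> 0"
  using prime_p prime_gt_0_nat by auto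

lemma prime_int_p: "prime (int p)"
  using prime_p by simp

text \<open>The reduced denominator divides the denominator of any other representation, so an
  arbitrary fraction can certify membership. The closure properties rest on this.\<close>

lemma Zp_iff: "x \<in> Zp \<longleftrightarrow> (\<exists>a b. \<not> int p dvd b \<and> x = of_int a / of_int b)"
proof
  assume "x \<in> Zp"
  then show "\<exists>a b. \<not> int p dvd b \<and> x = of_int a / of_int b"
    unfolding Zp_def by (metis (mono_tags) mem_Collect_eq prod.collapse quotient_of_div)
next
  assume "\<exists>a b. \<not> int p dvd b \<and> x = of_int a / of_int b"
  then obtain a b where ab: "\<not> int p dvd b" "x = of_int a / of_int b" by blast
  obtain c d where cd: "quotient_of x = (c, d)" by fastforce
  have b0: "b \<noteq> 0" using ab by auto
  have d0: "d > 0" using quotient_of_denom_pos[OF cd] .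
  have "of_int a / of_int b = (of_int c / of_int d :: rat)"
    using quotient_of_div[OF cd] ab by simp
  then have "of_int (a * d) = (of_int (c * b) :: rat)"
    using b0 d0 by (simp add: field_simps)
  then have "a * d = c * b" using of_int_eq_iff by blast
  then have "d dvd c * b" by (metis dvd_triv_right)
  moreover have "coprime d c" using quotient_of_coprime[OF cd] by (simp add: coprime_commute)
  ultimately have "d dvd b" using coprime_dvd_mult_right_iff by blast
  then show "x \<in> Zp" using ab cd unfolding Zp_def by (auto dest: dvd_trans)
qed

lemma Zp_of_int [simp, intro]: "of_int a \<in> Zp"
proof -
  have "\<not> int p dvd 1" using prime_int_p not_prime_unit by blast
  then show ?thesis unfolding Zp_iff by (intro exI[of _ a] exI[of _ 1]) auto
qed

lemma Zp_of_nat [simp, intro]: "of_nat a \<in> Zp"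
  using Zp_of_int[of "int a"] by simp

lemma Zp_numeral [simp, intro]: "numeral a \<in> Zp" "0 \<in> Zp" "1 \<in> Zp"
  using Zp_of_nat[of "numeral a"] Zp_of_nat[of 0] Zp_of_nat[of 1] by simp_all

lemma Zp_mult [intro]: "x \<in> Zp \<Longrightarrow> y \<in> Zp \<Longrightarrow> x * y \<in> Zp"
proof -
  assume "x \<in> Zp" "y \<in> Zp"
  then obtain a b c d where *: "\<not> int p dvd b" "x = of_int a / of_int b"
    "\<not> int p dvd d" "y = of_int c / of_int d" unfolding Zp_iff by blast
  then have "\<not> int p dvd b * d" using prime_int_p prime_dvd_mult_iff by blast
  then show ?thesis unfolding Zp_iff using *
    by (intro exI[of _ "a * c"] exI[of _ "b * d"]) auto
qed

lemma Zp_add [intro]: "x \<in> Zp \<Longrightarrow> y \<in> Zp \<Longrightarrow> x + y \<in> Zp"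
proof -
  assume "x \<in> Zp" "y \<in> Zp"
  then obtain a b c d where *: "\<not> int p dvd b" "x = of_int a / of_int b"
    "\<not> int p dvd d" "y = of_int c / of_int d" unfolding Zp_iff by blast
  then have "\<not> int p dvd b * d" using prime_int_p prime_dvd_mult_iff by blast
  moreover have "b \<noteq> 0" "d \<noteq> 0" using * by auto
  ultimately show ?thesis unfolding Zp_iff using *
    by (intro exI[of _ "a * d + c * b"] exI[of _ "b * d"]) (auto simp: field_simps)
qed

lemma Zp_uminus [intro]: "x \<in> Zp \<Longrightarrow> - x \<in> Zp"
  using Zp_mult[of "-1" x] Zp_of_int[of "-1"] by simp

lemma Zp_diff [intro]: "x \<in> Zp \<Longrightarrow> y \<in> Zp \<Longrightarrow> x - y \<in> Zp"
  using Zp_add[of x "-y"] Zp_uminus[of y] by simp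

lemma Zp_power [intro]: "x \<in> Zp \<Longrightarrow> x ^ n \<in> Zp"
  by (induction n) auto

lemma Zp_sum [intro]: "(\<And>i. i \<in> A \<Longrightarrow> f i \<in> Zp) \<Longrightarrow> sum f A \<in> Zp"
  by (induction A rule: infinite_finite_induct) auto

lemma Zp_prod [intro]: "(\<And>i. i \<in> A \<Longrightarrow> f i \<in> Zp) \<Longrightarrow> prod f A \<in> Zp"
  by (induction A rule: infinite_finite_induct) auto

lemmas Zp_intros = Zp_of_int Zp_of_nat Zp_numeral Zp_mult Zp_add Zp_uminus Zp_diff Zp_power Zp_sum Zp_prod

section \<open>Units of the localization\<close>

lemma Up_of_nat: "\<not> p dvd a \<Longrightarrow> of_nat a \<in> Up"
proof -
  assume a: "\<not> p dvd a"
  then have "a \<noteq> 0" by (metis dvd_0_right)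
  moreover have "inverse (of_nat a) \<in> Zp"
    unfolding Zp_iff using a by (intro exI[of _ 1] exI[of _ "int a"]) (simp add: divide_simps)
  ultimately show ?thesis unfolding Up_def by simp
qed

lemma Up_of_nat_less: "0 < a \<Longrightarrow> a < p \<Longrightarrow> of_nat a \<in> Up"
  by (rule Up_of_nat) (auto dest: dvd_imp_le)

lemma Up_fact: "n < p \<Longrightarrow> fact n \<in> Up"
  using Up_of_nat[of "fact n"] prime_dvd_fact_iff[OF prime_p, of n] by simp

lemma Up_1 [simp]: "1 \<in> Up"
  unfolding Up_def by simp

lemma Up_nz: "x \<in> Up \<Longrightarrow> x \<noteq> 0"
  unfolding Up_def by simp

lemma Up_Zp: "x \<in> Up \<Longrightarrow> x \<in> Zp"
  unfolding Up_def by simp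

lemma Up_mult: "x \<in> Up \<Longrightarrow> y \<in> Up \<Longrightarrow> x * y \<in> Up"
  unfolding Up_def by (auto simp: inverse_mult_distrib)

lemma Up_uminus: "x \<in> Up \<Longrightarrow> - x \<in> Up"
  unfolding Up_def by auto

lemma Up_power: "x \<in> Up \<Longrightarrow> x ^ n \<in> Up"
  by (induction n) (auto intro: Up_mult)

lemma Up_prod: "(\<And>i. i \<in> A \<Longrightarrow> f i \<in> Up) \<Longrightarrow> prod f A \<in> Up"
  by (induction A rule: infinite_finite_induct) (auto intro: Up_mult)

lemma Up_inverse: "x \<in> Up \<Longrightarrow> inverse x \<in> Up"
  unfolding Up_def by auto

lemma Zp_divide: "x \<in> Zp \<Longrightarrow> u \<in> Up \<Longrightarrow> x / u \<in> Zp"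
  unfolding Up_def by (auto simp: divide_inverse)

section \<open>The congruence relation and its compatibility with arithmetic\<close>

lemma cg_iff_Zp: "cg m x y \<longleftrightarrow> (x - y) / of_nat p ^ m \<in> Zp"
  by (simp add: cg_def rat_cong_def Zp_def)

lemma cg_iff: "cg m x y \<longleftrightarrow> (\<exists>z\<in>Zp. x = y + of_nat p ^ m * z)"
proof
  assume "cg m x y"
  then show "\<exists>z\<in>Zp. x = y + of_nat p ^ m * z"
    unfolding cg_iff_Zp by (intro bexI) auto
next
  assume "\<exists>z\<in>Zp. x = y + of_nat p ^ m * z"
  then show "cg m x y" unfolding cg_iff_Zp by auto
qed

lemma cgI: "z \<in> Zp \<Longrightarrow> x = y + of_nat p ^ m * z \<Longrightarrow> cg m x y"
  unfolding cg_iff by blast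

lemma cg_refl [simp]: "cg m x x"
  by (rule cgI[of 0]) auto

lemma cg_sym: "cg m x y \<Longrightarrow> cg m y x"
  unfolding cg_iff_Zp using Zp_uminus by (fastforce simp: diff_divide_distrib)

lemma cg_trans [trans]: "cg m x y \<Longrightarrow> cg m y z \<Longrightarrow> cg m x z"
  unfolding cg_iff_Zp using Zp_add by (fastforce simp: diff_divide_distrib)

lemma cg_eq_trans [trans]: "cg m x y \<Longrightarrow> y = z \<Longrightarrow> cg m x z" "x = y \<Longrightarrow> cg m y z \<Longrightarrow> cg m x z"
  by simp_all

lemma cg_add: "cg m x y \<Longrightarrow> cg m x' y' \<Longrightarrow> cg m (x + x') (y + y')"
  unfolding cg_iff_Zp using Zp_add[of "(x - y) / of_nat p ^ m" "(x' - y') / of_nat p ^ m"]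
  by (simp add: diff_divide_distrib add_divide_distrib algebra_simps)

lemma cg_scale: "cg m x y \<Longrightarrow> c \<in> Zp \<Longrightarrow> cg m (c * x) (c * y)"
  unfolding cg_iff_Zp using Zp_mult[of c "(x - y) / of_nat p ^ m"]
  by (simp add: algebra_simps)

lemma cg_uminus: "cg m x y \<Longrightarrow> cg m (- x) (- y)"
  using cg_scale[of m x y "-1"] Zp_of_int[of "-1"] by simp

lemma cg_diff: "cg m x y \<Longrightarrow> cg m x' y' \<Longrightarrow> cg m (x - x') (y - y')"
  using cg_add[of m x y "-x'" "-y'"] cg_uminus by simp

lemma cg_sum: "(\<And>i. i \<in> A \<Longrightarrow> cg m (f i) (g i)) \<Longrightarrow> cg m (sum f A) (sum g A)"
  by (induction A rule: infinite_finite_induct) (auto intro: cg_add)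

lemma cg_Zp: "cg m x y \<Longrightarrow> y \<in> Zp \<Longrightarrow> x \<in> Zp"
  unfolding cg_iff by auto

lemma cg_mult: "cg m x y \<Longrightarrow> cg m x' y' \<Longrightarrow> y \<in> Zp \<Longrightarrow> y' \<in> Zp \<Longrightarrow> cg m (x * x') (y * y')"
  using cg_trans[of m "x * x'" "x * y'" "y * y'"] cg_scale[of m x' y' x] cg_scale[of m x y y'] cg_Zp[of m x y]
  by (simp add: mult.commute)

lemma cg_power: "cg m x y \<Longrightarrow> y \<in> Zp \<Longrightarrow> cg m (x ^ n) (y ^ n)"
  by (induction n) (auto intro!: cg_mult)

lemma cg_prod: "(\<And>i. i \<in> A \<Longrightarrow> cg m (f i) (g i)) \<Longrightarrow> (\<And>i. i \<in> A \<Longrightarrow> g i \<in> Zp)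
    \<Longrightarrow> cg m (prod f A) (prod g A)"
  by (induction A rule: infinite_finite_induct) (auto intro!: cg_mult)

lemma cg_mono: "cg m x y \<Longrightarrow> k \<le> m \<Longrightarrow> cg k x y"
proof -
  assume "cg m x y" "k \<le> m"
  then obtain z where z: "z \<in> Zp" "x = y + of_nat p ^ m * z" unfolding cg_iff by blast
  have "x = y + of_nat p ^ k * (of_nat p ^ (m - k) * z)"
    using z \<open>k \<le> m\<close> by (simp add: mult.assoc[symmetric] power_add[symmetric])
  then show ?thesis using z by (intro cgI[of "of_nat p ^ (m - k) * z"]) auto
qed

text \<open>Trades an explicit factor \<open>p^k\<close> for precision: what carries a factor
  \<open>p^3\<close> need only be known modulo \<open>p\<close> to be known modulo
  \<open>p^4\<close>.\<close>

lemma cg_p_mult: "cg (m + k) (of_nat p ^ k * x) (of_nat p ^ k * y) \<longleftrightarrow> cg m x y"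
  unfolding cg_iff_Zp by (simp add: power_add right_diff_distrib[symmetric])

lemma cg_cancel: "cg m (u * x) (u * y) \<Longrightarrow> u \<in> Up \<Longrightarrow> cg m x y"
proof -
  assume a: "cg m (u * x) (u * y)" "u \<in> Up"
  have "cg m (inverse u * (u * x)) (inverse u * (u * y))"
    using a by (intro cg_scale[OF a(1)]) (auto simp: Up_def)
  moreover have "inverse u * (u * x) = x" "inverse u * (u * y) = y" using Up_nz[OF a(2)] by simp_all
  ultimately show ?thesis by simp
qed

text \<open>Cross-multiply, then cancel the unit \<open>u * v\<close>.\<close>

lemma cg_divide: "cg m x y \<Longrightarrow> cg m u v \<Longrightarrow> y \<in> Zp \<Longrightarrow> u \<in> Up \<Longrightarrow> v \<in> Up \<Longrightarrow> cg m (x / u) (y / v)"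
proof -
  assume a: "cg m x y" "cg m u v" "y \<in> Zp" "u \<in> Up" "v \<in> Up"
  have "cg m (x * v) (y * u)" using a by (intro cg_mult cg_sym[OF a(2)]) (auto dest: Up_Zp)
  moreover have "u * v * (x / u) = x * v" "u * v * (y / v) = y * u"
    using Up_nz[OF a(4)] Up_nz[OF a(5)] by simp_all
  ultimately show ?thesis using cg_cancel[OF _ Up_mult[OF a(4,5)]] by metis
qed

lemma cg_int: "[a = b] (mod int p) \<Longrightarrow> cg 1 (of_int a) (of_int b)"
proof -
  assume "[a = b] (mod int p)"
  then obtain k where "a = b + int p * k"
    by (metis cong_iff_lin cong_sym mult.commute add.commute)
  then show ?thesis by (intro cgI[of "of_int k"]) auto
qed

lemma fermat: "0 < i \<Longrightarrow> i < p \<Longrightarrow> cg 1 (of_nat i ^ (p - 1)) 1"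
proof -
  assume i: "0 < i" "i < p"
  then have "\<not> p dvd i" by (auto dest: dvd_imp_le)
  then have "[i ^ (p - 1) = 1] (mod p)" using fermat_theorem[OF prime_p] by blast
  then have "[int (i ^ (p - 1)) = int 1] (mod int p)" by (simp only: cong_int_iff)
  from cg_int[OF this] show ?thesis by simp
qed

end

section \<open>Bernoulli numbers and harmonic sums\<close>

lemma sum_reflect_half:
  fixes f :: "nat \<Rightarrow> 'a::comm_monoid_add"
  shows "(\<Sum>i=1..2*h. f i) = (\<Sum>i=1..h. f i + f (2*h + 1 - i))"
proof -
  have "(\<Sum>i=1..2*h. f i) = (\<Sum>i=1..h. f i) + (\<Sum>i=h+1..2*h. f i)"
    by (subst sum.union_disjoint[symmetric]) (auto intro: sum.cong)
  also have "(\<Sum>i=h+1..2*h. f i) = (\<Sum>i=1..h. f (2*h + 1 - i))"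
    by (rule sum.reindex_bij_witness[of _ "\<lambda>i. 2*h+1-i" "\<lambda>i. 2*h+1-i"]) auto
  finally show ?thesis by (simp add: sum.distrib)
qed

lemma prod_reflect_half:
  fixes f :: "nat \<Rightarrow> 'a::comm_monoid_mult"
  shows "(\<Prod>i=1..2*h. f i) = (\<Prod>i=1..h. f i * f (2*h + 1 - i))"
proof -
  have "(\<Prod>i=1..2*h. f i) = (\<Prod>i=1..h. f i) * (\<Prod>i=h+1..2*h. f i)"
    by (subst prod.union_disjoint[symmetric]) (auto intro: prod.cong)
  also have "(\<Prod>i=h+1..2*h. f i) = (\<Prod>i=1..h. f (2*h + 1 - i))"
    by (rule prod.reindex_bij_witness[of _ "\<lambda>i. 2*h+1-i" "\<lambda>i. 2*h+1-i"]) auto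
  finally show ?thesis by (simp add: prod.distrib)
qed

text \<open>The odd numbers up to \<open>2 h\<close> are exactly the \<open>2 h + 1 - 2 i\<close>.
  With \<open>p = 2 h + 1\<close> they are the reflections \<open>p - 2 i\<close> of the even
  ones.\<close>

lemma sum_even_odd_half:
  fixes f :: "nat \<Rightarrow> 'a::comm_monoid_add"
  shows "(\<Sum>i=1..2*h. f i) = (\<Sum>i=1..h. f (2*i) + f (2*h + 1 - 2*i))"
proof -
  have "(\<Sum>i=1..2*h. f i) = (\<Sum>i=1..h. f (2*i)) + (\<Sum>i=1..h. f (2*i-1))"
    by (induction h) (simp_all add: add_ac)
  also have "(\<Sum>i=1..h. f (2*i-1)) = (\<Sum>i=1..h. f (2*h + 1 - 2*i))"
    by (rule sum.reindex_bij_witness[of _ "\<lambda>i. h+1-i" "\<lambda>i. h+1-i"])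
       (auto intro!: arg_cong[of _ _ f])
  finally show ?thesis by (simp add: sum.distrib)
qed

text \<open>Compares coefficients in the geometric sum \<open>(e^(N X) - 1) / (e^X - 1)\<close>,
  written as the product of \<open>X / (e^X - 1)\<close> and
  \<open>(e^(N X) - 1) / X\<close>.\<close>

lemma bernoulli_power_sum:
  assumes "m > 0"
  shows "(\<Sum>i<N. of_nat i ^ m) = (\<Sum>j=0..m. bernoulli j * fact m / (fact j * fact (m - j + 1)) * of_nat N ^ (m - j + 1))"
proof -
  \<comment> \<open>\<open>E\<close> and \<open>F\<close> are \<open>e^X - 1\<close> and
    \<open>e^(N X) - 1\<close> divided by \<open>X\<close>. Unlike \<open>e^X - 1\<close> itself,
    \<open>E\<close> has a nonzero constant term and hence an inverse.\<close>
  define E where "E = (Abs_fps (\<lambda>n. 1 / fact (n + 1)) :: rat fps)"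
  define F where "F = (Abs_fps (\<lambda>n. of_nat N ^ (n + 1) / fact (n + 1)) :: rat fps)"
  have E0: "fps_nth E 0 \<noteq> 0" by (simp add: E_def)
  have XE: "fps_X * E = fps_exp 1 - 1"
  proof (rule fps_ext)
    show "fps_nth (fps_X * E) n = fps_nth (fps_exp 1 - 1) n" for n
      by (cases n) (simp_all add: E_def fps_X_mult_nth algebra_simps)
  qed
  have XF: "fps_X * F = fps_exp (of_nat N) - 1"
  proof (rule fps_ext)
    show "fps_nth (fps_X * F) n = fps_nth (fps_exp (of_nat N) - 1) n" for n
      by (cases n) (simp_all add: F_def fps_X_mult_nth algebra_simps)
  qed
  have "(fps_exp 1 - 1) * (\<Sum>i<N. fps_exp (of_nat i :: rat)) = fps_exp (of_nat N) - 1"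
  proof (induction N)
    case (Suc N)
    have "fps_exp (1 :: rat) * fps_exp (of_nat N) = fps_exp (of_nat (Suc N))"
      by (subst fps_exp_add_mult[symmetric]) simp
    then show ?case using Suc by (simp add: algebra_simps)
  qed simp
  then have "fps_X * (E * (\<Sum>i<N. fps_exp (of_nat i :: rat))) = fps_X * F"
    using XE XF by (simp add: mult.assoc[symmetric])
  then have "E * (\<Sum>i<N. fps_exp (of_nat i :: rat)) = F" by simp
  then have "inverse E * F = inverse E * E * (\<Sum>i<N. fps_exp (of_nat i :: rat))"
    by (simp add: mult.assoc)
  then have *: "(\<Sum>i<N. fps_exp (of_nat i :: rat)) = inverse E * F"
    using inverse_mult_eq_1[OF E0] by simp
  have "(\<Sum>i<N. of_nat i ^ m) = fact m * fps_nth (\<Sum>i<N. fps_exp (of_nat i :: rat)) m"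
    by (simp add: fps_sum_nth sum_distrib_left)
  also have "\<dots> = fact m * (\<Sum>j=0..m. fps_nth (inverse E) j * fps_nth F (m - j))"
    unfolding * fps_mult_nth ..
  also have "\<dots> = (\<Sum>j=0..m. bernoulli j * fact m / (fact j * fact (m - j + 1)) * of_nat N ^ (m - j + 1))"
    unfolding sum_distrib_left
    by (rule sum.cong) (simp_all add: F_def bernoulli_def E_def)
  finally show ?thesis .
qed

context rat_localization
begin

text \<open>The recursion for the inverse series involves only the coefficients
  \<open>1 / (i + 1)!\<close> with \<open>i <= m\<close>, and \<open>m + 1 < p\<close> makes these
  factorials units.\<close>

lemma bernoulli_Zp:
  assumes "m + 2 \<le> p" shows "bernoulli m \<in> Zp"
proof -
  define E where "E = (Abs_fps (\<lambda>n. 1 / fact (n + 1)) :: rat fps)"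
  have "m + 2 \<le> p \<Longrightarrow> fps_nth (inverse E) m \<in> Zp"
  proof (induction m rule: less_induct)
    case (less m)
    show ?case
    proof (cases "m = 0")
      case True
      then show ?thesis by (simp add: E_def)
    next
      case False
      have "fps_nth (inverse E * E) m = 0"
        using False inverse_mult_eq_1[of E] by (simp add: E_def)
      then have "(\<Sum>i<m. fps_nth (inverse E) i * fps_nth E (m - i)) + fps_nth (inverse E) m = 0"
        unfolding fps_mult_nth
        by (simp add: atLeast0AtMost lessThan_Suc_atMost[symmetric] E_def)
      then have "fps_nth (inverse E) m = - (\<Sum>i<m. fps_nth (inverse E) i * fps_nth E (m - i))"
        by simp
      moreover have "fps_nth E i \<in> Zp" if "i \<le> m" for i
        using that less.prems unfolding E_def fps_nth_Abs_fps
        by (intro Zp_divide Up_fact) auto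
      ultimately show ?thesis using less
        by (auto intro!: Zp_uminus Zp_sum Zp_mult)
    qed
  qed
  then show ?thesis using assms Up_Zp[OF Up_fact[of m]] unfolding bernoulli_def E_def[symmetric]
    by (intro Zp_mult) auto
qed

text \<open>In the power sum formula for \<open>N = p\<close> only the term \<open>j = m\<close> is
  linear in \<open>p\<close>; all others carry \<open>p^2\<close> with p-integral
  coefficients.\<close>

lemma power_sum_cg:
  assumes "m > 0" "m + 2 \<le> p"
  shows "cg 2 (\<Sum>i=1..p-1. of_nat i ^ m) (of_nat p * bernoulli m)"
proof -
  define b where "b j = bernoulli j * fact m / (fact j * fact (m - j + 1))" for j
  have bZ: "b j \<in> Zp" if "j \<le> m" for j
    unfolding b_def using that assms
    by (intro Zp_divide Zp_mult bernoulli_Zp Up_mult Up_fact Up_Zp[OF Up_fact]) auto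
  have "(\<Sum>i=1..p-1. of_nat i ^ m) = (\<Sum>i<p. of_nat i ^ m :: rat)"
    using assms by (intro sum.mono_neutral_left) auto
  also have "\<dots> = (\<Sum>j=0..m. b j * of_nat p ^ (m - j + 1))"
    unfolding bernoulli_power_sum[OF assms(1)] b_def ..
  also have "\<dots> = (\<Sum>j<m. b j * of_nat p ^ (m - j + 1)) + of_nat p * bernoulli m"
    by (simp add: atLeast0AtMost lessThan_Suc_atMost[symmetric] b_def)
  also have "cg 2 \<dots> (0 + of_nat p * bernoulli m)"
  proof (intro cg_add cg_refl)
    have "cg 2 (b j * of_nat p ^ (m - j + 1)) 0" if "j < m" for j
    proof -
      have "m - j + 1 = 2 + (m - j - 1)" using that by simp
      then have "b j * of_nat p ^ (m - j + 1) = 0 + of_nat p ^ 2 * (b j * of_nat p ^ (m - j - 1))"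
        by (simp only: power_add) simp
      then show ?thesis using bZ[of j] that by (intro cgI[of "b j * of_nat p ^ (m - j - 1)"]) auto
    qed
    then show "cg 2 (\<Sum>j<m. b j * of_nat p ^ (m - j + 1)) 0"
      using cg_sum[of "{..<m}" 2 "\<lambda>j. b j * of_nat p ^ (m - j + 1)" "\<lambda>_. 0"] by simp
  qed
  finally show ?thesis by simp
qed

text \<open>\<open>g\<close> is the first-order term of \<open>f\<close> under reflection, and
  doubling the index scales \<open>f\<close> by \<open>c\<close> and \<open>g\<close> by
  \<open>d\<close>. The two pairings give \<open>2 A - p T\<close> and \<open>2 c A - p d T\<close>
  for \<open>Q\<close>; subtracting the second from \<open>c\<close> times the first eliminates
  \<open>A\<close>.\<close>

lemma doubling_cg:
  fixes f g :: "nat \<Rightarrow> rat"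
  assumes h: "p = 2 * h + 1"
    and reflect: "\<And>i. 0 < i \<Longrightarrow> i < p \<Longrightarrow> cg 2 (f (p - i)) (f i - of_nat p * g i)"
    and f2: "\<And>i. 1 \<le> i \<Longrightarrow> i \<le> h \<Longrightarrow> f (2 * i) = c * f i"
    and g2: "\<And>i. 1 \<le> i \<Longrightarrow> i \<le> h \<Longrightarrow> g (2 * i) = d * g i"
    and c: "c \<in> Zp"
  shows "cg 2 ((c - 1) * (\<Sum>i=1..p-1. f i)) (of_nat p * (d - c) * (\<Sum>i=1..h. g i))"
proof -
  define Q A T where "Q = (\<Sum>i=1..p-1. f i)" and "A = (\<Sum>i=1..h. f i)" and "T = (\<Sum>i=1..h. g i)"
  have "Q = (\<Sum>i=1..h. f i + f (p - i))"
    unfolding Q_def using sum_reflect_half[of f h] h by simp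
  also have "cg 2 \<dots> (\<Sum>i=1..h. f i + (f i - of_nat p * g i))"
    using h by (intro cg_sum cg_add cg_refl reflect) auto
  also have "\<dots> = 2 * A - of_nat p * T"
    unfolding A_def T_def by (simp add: sum.distrib sum_subtractf sum_distrib_left)
  finally have 1: "cg 2 Q (2 * A - of_nat p * T)" .
  have "Q = (\<Sum>i=1..h. f (2 * i) + f (p - 2 * i))"
    unfolding Q_def using sum_even_odd_half[of f h] h by simp
  also have "cg 2 \<dots> (\<Sum>i=1..h. f (2*i) + (f (2*i) - of_nat p * g (2*i)))"
    using h by (intro cg_sum cg_add cg_refl reflect) auto
  also have "\<dots> = (\<Sum>i=1..h. c * f i + (c * f i - of_nat p * (d * g i)))"
    by (intro sum.cong) (auto simp: f2 g2)
  also have "\<dots> = 2 * c * A - of_nat p * d * T"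
    unfolding A_def T_def by (simp add: sum.distrib sum_subtractf sum_distrib_left mult_ac)
  finally have 2: "cg 2 Q (2 * c * A - of_nat p * d * T)" .
  have "cg 2 (c * Q - Q) (c * (2 * A - of_nat p * T) - (2 * c * A - of_nat p * d * T))"
    using 1 2 c by (intro cg_diff cg_scale)
  then show ?thesis unfolding Q_def[symmetric] T_def[symmetric] by (simp add: algebra_simps)
qed

text \<open>The binomial theorem to first order, with exponent \<open>Suc m\<close> to avoid
  subtraction in the derivative. The witness in the induction step is the product of the two
  first-order terms, the only one dropped.\<close>

lemma power_add_p_cg:
  assumes "a \<in> Zp" "y \<in> Zp"
  shows "cg 2 ((a + of_nat p * y) ^ Suc m) (a ^ Suc m + of_nat p * (of_nat (Suc m) * y * a ^ m))"
proof (induction m)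
  case (Suc m)
  have "cg 2 ((a + of_nat p * y) ^ Suc m * (a + of_nat p * y))
     ((a ^ Suc m + of_nat p * (of_nat (Suc m) * y * a ^ m)) * (a + of_nat p * y))"
    by (intro cg_mult Suc cg_refl Zp_intros assms)
  also have "cg 2 \<dots> (a ^ Suc (Suc m) + of_nat p * (of_nat (Suc (Suc m)) * y * a ^ Suc m))"
    using assms by (intro cgI[of "of_nat (Suc m) * y^2 * a ^ m"])
      ((intro Zp_intros assms)+, simp add: algebra_simps power2_eq_square)
  finally show ?case by (simp only: power_Suc2)
qed simp

end

section \<open>Half-range reciprocal sums\<close>

locale rat_localization_ge5 = rat_localization +
  assumes p_ge_5: "p \<ge> 5"
begin

definition h :: nat where "h = (p - 1) div 2"

lemma p_h: "p = 2 * h + 1"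
proof -
  have "odd p" using prime_p p_ge_5 prime_odd_nat by force
  then show ?thesis unfolding h_def by simp
qed

lemma p_minus_1: "p - 1 = 2 * h" using p_h by simp

lemma sum_reflect_p: "(\<Sum>i=1..p-1. f i) = (\<Sum>i=1..h. f i + f (p - i))"
  unfolding p_minus_1 sum_reflect_half using p_h by (metis (no_types, lifting))

lemma prod_reflect_p: "(\<Prod>i=1..p-1. f i) = (\<Prod>i=1..h. f i * f (p - i))"
  unfolding p_minus_1 prod_reflect_half using p_h by (metis (no_types, lifting))

lemma le_h_less_p: "i \<le> h \<Longrightarrow> i < p" using p_h by linarith

lemma Up_2: "2 \<in> Up" using Up_of_nat_less[of 2] p_ge_5 by simp

lemma Up_3: "3 \<in> Up" using Up_of_nat_less[of 3] p_ge_5 by simp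

text \<open>Uses \<open>doubling_cg\<close> with \<open>f i = i^(p-3)\<close>,
  \<open>g i = (p-3) i^(p-4)\<close>, \<open>c = 2^(p-3)\<close>, \<open>d = 2^(p-4)\<close>. The
  full sum is \<open>p\<close> times the Bernoulli number, so one \<open>p\<close> cancels, and
  Fermat's theorem turns \<open>i^(p-4)\<close> into \<open>1 / i^3\<close>.\<close>

lemma half_cubes_cg: "cg 1 (\<Sum>i=1..h. 1 / of_nat i ^ 3) (- 2 * bernoulli (p - 3))"
proof -
  define m where "m = p - 5"
  define B where "B = bernoulli (p - 3)"
  have pm: "p - 3 = Suc (Suc m)" "p - 4 = Suc m" "p - 1 = m + 4" "p = m + 5" using p_ge_5 by (auto simp: m_def)
  \<comment> \<open>The exponent \<open>p - 3\<close> is even, so \<open>p - i\<close> may be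
    replaced by \<open>i - p\<close> and expanded around \<open>i\<close>.\<close>
  have even: "even (Suc (Suc m))" 
  proof -
    have "Suc (Suc m) = 2 * (h - 1)" using p_h p_ge_5 by (simp add: m_def)
    then show ?thesis by simp
  qed
  define T where "T = (\<Sum>i=1..h. of_nat i ^ Suc m :: rat)"
  have TZ: "T \<in> Zp" unfolding T_def by (intro Zp_intros)
  have BZ: "B \<in> Zp" unfolding B_def using p_ge_5 by (intro bernoulli_Zp) simp
  have two: "cg 1 (2 ^ m * 16) 1" using fermat[of 2] p_ge_5 unfolding pm(3) by (simp add: power_add mult.commute)
  have refl: "cg 2 (of_nat (p - i) ^ Suc (Suc m)) (of_nat i ^ Suc (Suc m) - of_nat p * (of_nat (Suc (Suc m)) * of_nat i ^ Suc m))"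
    if "i < p" for i
  proof -
    have "of_nat (p - i) ^ Suc (Suc m) = (of_nat i + of_nat p * - 1 :: rat) ^ Suc (Suc m)"
      using that power_minus_even[OF even, of "of_nat p - of_nat i :: rat"] by (simp add: of_nat_diff)
    also have "cg 2 \<dots> (of_nat i ^ Suc (Suc m) + of_nat p * (of_nat (Suc (Suc m)) * - 1 * of_nat i ^ Suc m))"
      by (intro power_add_p_cg Zp_intros)
    finally show ?thesis by (simp only: mult_minus_right mult_minus_left mult_1_right add_uminus_conv_diff)
  qed
  have "cg 2 ((2 ^ Suc (Suc m) - 1) * (\<Sum>i=1..p-1. of_nat i ^ Suc (Suc m)))
     (of_nat p * (2 ^ Suc m - 2 ^ Suc (Suc m)) * (\<Sum>i=1..h. of_nat (Suc (Suc m)) * of_nat i ^ Suc m))"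
  proof (rule doubling_cg[OF p_h])
    show "cg 2 (of_nat (p - i) ^ Suc (Suc m)) (of_nat i ^ Suc (Suc m) - of_nat p * (of_nat (Suc (Suc m)) * of_nat i ^ Suc m))"
      if "i < p" for i using refl that .
  qed (auto simp: power_mult_distrib simp del: power_Suc intro!: Zp_intros)
  moreover have "cg 2 ((2 ^ Suc (Suc m) - 1) * (\<Sum>i=1..p-1. of_nat i ^ Suc (Suc m)))
     ((2 ^ Suc (Suc m) - 1) * (of_nat p * B))"
    unfolding B_def pm(1) by (intro cg_scale power_sum_cg Zp_intros) (use pm in auto)
  ultimately have "cg 2 ((2 ^ Suc (Suc m) - 1) * (of_nat p * B))
     (of_nat p * (2 ^ Suc m - 2 ^ Suc (Suc m)) * (\<Sum>i=1..h. of_nat (Suc (Suc m)) * of_nat i ^ Suc m))"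
    using cg_sym cg_trans by blast
  then have "cg (1 + 1) (of_nat p ^ 1 * ((2 ^ Suc (Suc m) - 1) * B))
     (of_nat p ^ 1 * ((2 ^ Suc m - 2 ^ Suc (Suc m)) * (of_nat (Suc (Suc m)) * T)))"
    unfolding T_def by (simp only: sum_distrib_left mult_ac power_one_right one_add_one)
  then have "cg 1 ((2 ^ Suc (Suc m) - 1) * B) ((2 ^ Suc m - 2 ^ Suc (Suc m)) * (of_nat (Suc (Suc m)) * T))"
    unfolding cg_p_mult .
  \<comment> \<open>The factor 4 turns the powers of two into multiples of
    \<open>2^m * 16 = 2^(p-1)\<close>, which is 1 modulo \<open>p\<close>.\<close>
  then have "cg 1 (4 * ((2 ^ Suc (Suc m) - 1) * B)) (4 * ((2 ^ Suc m - 2 ^ Suc (Suc m)) * (of_nat (Suc (Suc m)) * T)))"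
    by (rule cg_scale) auto
  moreover have "4 * ((2 ^ Suc (Suc m) - 1) * B) = 2 ^ m * 16 * B - 4 * B"
    by (simp add: algebra_simps)
  moreover have "4 * ((2 ^ Suc m - 2 ^ Suc (Suc m)) * (of_nat (Suc (Suc m)) * T)) = 2 ^ m * 16 * (- (of_nat (Suc (Suc m)) * T) / 2)"
    by (simp add: field_simps)
  ultimately have 1: "cg 1 (2 ^ m * 16 * B - 4 * B) (2 ^ m * 16 * (- (of_nat (Suc (Suc m)) * T) / 2))"
    by (simp only:)
  have "cg 1 (1 * B - 4 * B) (2 ^ m * 16 * B - 4 * B)"
    by (intro cg_diff cg_refl cg_mult cg_sym[OF two] BZ Zp_intros)
  also note 1
  also have "cg 1 (2 ^ m * 16 * (- (of_nat (Suc (Suc m)) * T) / 2)) (1 * (- (of_nat (Suc (Suc m)) * T) / 2))"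
    by (intro cg_mult two cg_refl Zp_intros Zp_divide TZ Up_2)
  finally have "cg 1 (2 * (1 * B - 4 * B)) (2 * (1 * (- (of_nat (Suc (Suc m)) * T) / 2)))"
    by (rule cg_scale) auto
  then have "cg 1 (- 6 * B) (- (of_nat (Suc (Suc m)) * T))" by simp
  \<comment> \<open>\<open>m + 2 = p - 3\<close> is \<open>-3\<close> modulo
    \<open>p\<close>.\<close>
  also have "cg 1 \<dots> (3 * T)"
  proof (rule cgI[of "- T"])
    have "of_nat p = (of_nat m + 5 :: rat)" using arg_cong[OF pm(4), of of_nat] by simp
    then show "- (of_nat (Suc (Suc m)) * T) = 3 * T + of_nat p ^ 1 * - T"
      by (simp add: algebra_simps)
  qed (use TZ in auto)
  finally have "cg 1 (3 * (- 2 * B)) (3 * T)" by simp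
  then have "cg 1 (- 2 * B) T" using Up_3 by (rule cg_cancel)
  also have "cg 1 T (\<Sum>i=1..h. 1 / of_nat i ^ 3)"
    unfolding T_def
  proof (rule cg_sum)
    fix i assume i: "i \<in> {1..h}"
    then have u: "of_nat i ^ 3 \<in> Up" using p_h by (intro Up_power Up_of_nat_less) auto
    have "cg 1 (of_nat i ^ (p - 1)) 1" using i p_h by (intro fermat) auto
    then have "cg 1 (of_nat i ^ 3 * of_nat i ^ Suc m) (of_nat i ^ 3 * (1 / of_nat i ^ 3))"
      using Up_nz[OF u] unfolding pm(3) by (simp add: power_add mult_ac power3_eq_cube eval_nat_numeral)
    then show "cg 1 (of_nat i ^ Suc m) (1 / of_nat i ^ 3)" using u by (rule cg_cancel)
  qed
  finally show ?thesis unfolding B_def by (rule cg_sym)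
qed

lemma Up_diff: "0 < i \<Longrightarrow> i < p \<Longrightarrow> of_nat p - of_nat i \<in> Up"
  using Up_of_nat_less[of "p - i"] by (simp add: of_nat_diff)

text \<open>\<open>doubling_cg\<close> again, with \<open>f i = 1 / i^2\<close>,
  \<open>g i = -2 / i^3\<close>, \<open>c = 1/4\<close>, \<open>d = 1/8\<close>; the unit
  \<open>-3/4\<close> is then cancelled.\<close>

lemma reciprocal_squares_cg:
  "cg 2 (\<Sum>i=1..p-1. 1 / of_nat i ^ 2) (of_nat p * (- 1 / 3) * (\<Sum>i=1..h. 1 / of_nat i ^ 3))"
proof -
  have quarter: "1 / 4 \<in> Zp" using Zp_divide[OF _ Up_power[OF Up_2, of 2], of 1] by simp
  have "cg 2 ((1 / 4 - 1) * (\<Sum>i=1..p-1. 1 / of_nat i ^ 2)) (of_nat p * (1 / 8 - 1 / 4) * (\<Sum>i=1..h. - 2 / of_nat i ^ 3))"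
  proof (rule doubling_cg[OF p_h _ _ _ quarter])
    fix i assume i: "0 < i" "i < p"
    define x y where "x = (of_nat i :: rat)" and "y = (of_nat p - of_nat i :: rat)"
    have xy: "x \<in> Up" "y \<in> Up" using Up_of_nat_less Up_diff i by (auto simp: x_def y_def)
    have py: "of_nat p = x + y" by (simp add: x_def y_def)
    have "cg 2 (1 / y ^ 2) (1 / x ^ 2 - of_nat p * (- 2 / x ^ 3))"
    proof (rule cgI)
      \<comment> \<open>The exact error, divided by \<open>p^2\<close>, of the first-order expansion
        of \<open>1 / (p - x)^2\<close> around \<open>p = 0\<close>.\<close>
      show "(3 * x - 2 * of_nat p) / (x ^ 3 * y ^ 2) \<in> Zp"
        by (intro Zp_divide Zp_intros Up_mult Up_power xy Up_Zp)
      show "1 / y ^ 2 = 1 / x ^ 2 - of_nat p * (- 2 / x ^ 3) + of_nat p ^ 2 * ((3 * x - 2 * of_nat p) / (x ^ 3 * y ^ 2))"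
        unfolding py using Up_nz[OF xy(1)] Up_nz[OF xy(2)]
        by (simp add: field_simps) (simp add: algebra_simps eval_nat_numeral)
    qed
    then show "cg 2 (1 / of_nat (p - i) ^ 2) (1 / of_nat i ^ 2 - of_nat p * (- 2 / of_nat i ^ 3))"
      using i by (simp add: of_nat_diff x_def y_def)
  qed (auto simp: field_simps)
  then have "cg 2 ((- 3 / 4) * (\<Sum>i=1..p-1. 1 / of_nat i ^ 2)) (of_nat p * (1 / 4) * (\<Sum>i=1..h. 1 / of_nat i ^ 3))"
    by (simp add: sum_distrib_left)
  then have "cg 2 ((- 3 / 4) * (\<Sum>i=1..p-1. 1 / of_nat i ^ 2)) ((- 3 / 4) * (of_nat p * (- 1 / 3) * (\<Sum>i=1..h. 1 / of_nat i ^ 3)))"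
    by simp
  moreover have "- 3 / 4 \<in> Up" 
    using Up_mult[OF Up_uminus[OF Up_3] Up_inverse[OF Up_power[OF Up_2, of 2]]] by (simp add: field_simps)
  ultimately show ?thesis by (rule cg_cancel)
qed

text \<open>\<open>1 / i^2 + 1 / (p - i)^2 + 2 / (i (p - i))\<close> is the square of
  \<open>p / (i (p - i))\<close>, hence 0 modulo \<open>p^2\<close>. So the sum is
  \<open>-1/2\<close> times the full sum of \<open>1 / i^2\<close>.\<close>

lemma reciprocal_products_cg:
  "cg 2 (\<Sum>i=1..h. 1 / (of_nat i * (of_nat p - of_nat i))) (- (of_nat p * bernoulli (p - 3)) / 3)"
proof -
  define S Q T where "S = (\<Sum>i=1..h. 1 / (of_nat i * (of_nat p - of_nat i) :: rat))"
    and "Q = (\<Sum>i=1..p-1. 1 / of_nat i ^ 2 :: rat)" and "T = (\<Sum>i=1..h. 1 / of_nat i ^ 3 :: rat)"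
  have "T \<in> Zp" unfolding T_def using p_h
    by (intro Zp_sum Zp_divide Zp_intros Up_power Up_of_nat_less) auto
  have "Q = (\<Sum>i=1..h. 1 / of_nat i ^ 2 + 1 / (of_nat p - of_nat i) ^ 2)"
    unfolding Q_def sum_reflect_p
    by (intro sum.cong) (simp_all add: of_nat_diff less_imp_le[OF le_h_less_p])
  also have "cg 2 \<dots> (\<Sum>i=1..h. (- 2) * (1 / (of_nat i * (of_nat p - of_nat i))))"
  proof (rule cg_sum)
    fix i assume i: "i \<in> {1..h}"
    define x y where "x = (of_nat i :: rat)" and "y = (of_nat p - of_nat i :: rat)"
    have xy: "x \<in> Up" "y \<in> Up" using Up_of_nat_less Up_diff i p_h by (auto simp: x_def y_def)
    have py: "of_nat p = x + y" by (simp add: x_def y_def)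
    have "cg 2 (1 / x ^ 2 + 1 / y ^ 2) ((- 2) * (1 / (x * y)))"
    proof (rule cgI)
      show "1 / (x ^ 2 * y ^ 2) \<in> Zp"
        by (intro Zp_divide Zp_intros Up_mult Up_power xy Up_Zp)
      show "1 / x ^ 2 + 1 / y ^ 2 = (- 2) * (1 / (x * y)) + of_nat p ^ 2 * (1 / (x ^ 2 * y ^ 2))"
        unfolding py using Up_nz[OF xy(1)] Up_nz[OF xy(2)]
        by (simp add: field_simps) (simp add: algebra_simps eval_nat_numeral)
    qed
    then show "cg 2 (1 / of_nat i ^ 2 + 1 / (of_nat p - of_nat i) ^ 2) ((- 2) * (1 / (of_nat i * (of_nat p - of_nat i))))"
      by (simp add: x_def y_def)
  qed
  also have "\<dots> = - 2 * S" unfolding S_def sum_distrib_left ..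
  finally have "cg 2 (- 2 * S) Q" by (rule cg_sym)
  also have "cg 2 Q (of_nat p * (- 1 / 3) * T)" unfolding Q_def T_def by (rule reciprocal_squares_cg)
  \<comment> \<open>\<open>T\<close> is known only modulo \<open>p\<close>; the prefactor
    \<open>p\<close> lifts this to \<open>p^2\<close>.\<close>
  also have "cg 2 \<dots> (of_nat p * (- 1 / 3) * (- 2 * bernoulli (p - 3)))"
  proof -
    have "cg 1 ((- 1 / 3) * T) ((- 1 / 3) * (- 2 * bernoulli (p - 3)))"
      using half_cubes_cg Zp_divide[OF _ Up_3, of "-1"] Zp_of_int[of "-1"] unfolding T_def by (intro cg_scale) auto
    then have "cg (1 + 1) (of_nat p ^ 1 * ((- 1 / 3) * T)) (of_nat p ^ 1 * ((- 1 / 3) * (- 2 * bernoulli (p - 3))))"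
      unfolding cg_p_mult .
    then show ?thesis by (simp add: mult_ac numeral_2_eq_2)
  qed
  finally have "cg 2 (- 2 * S) (- 2 * (- (of_nat p * bernoulli (p - 3)) / 3))" by (simp add: mult.left_commute)
  then show ?thesis using Up_uminus[OF Up_2] unfolding S_def by (rule cg_cancel)
qed

end

section \<open>Binomial coefficients of multiples of the prime\<close>

lemma fact_add_prod:
  "(fact (m + q) :: 'a :: {semiring_char_0, comm_semiring_1}) = fact m * (\<Prod>i=1..q. of_nat (m + i))"
  by (induction q) (simp_all add: mult_ac add_ac)

text \<open>The last factor of each block of \<open>p\<close> consecutive ones is the multiple of
  \<open>p\<close>; together these contribute \<open>p^n n!\<close>.\<close>

lemma fact_mult_prod:
  "(fact (n * p) :: 'a :: {semiring_char_0, comm_semiring_1}) = of_nat p ^ n * fact n * (\<Prod>N<n. \<Prod>i=1..p-1. of_nat (N * p + i))"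
  if "p > 0"
proof (induction n)
  case (Suc n)
  have "(fact (Suc n * p) :: 'a) = fact (n * p) * (\<Prod>i=1..p. of_nat (n * p + i))"
    using fact_add_prod[of "n * p" p] by (simp add: add.commute)
  also have "(\<Prod>i=1..p. of_nat (n * p + i)) = (\<Prod>i=1..p-1. of_nat (n * p + i) :: 'a) * of_nat (Suc n * p)"
    using that by (cases p) (simp_all add: add_ac)
  finally show ?case by (simp add: Suc algebra_simps)
qed simp

context rat_localization_ge5
begin

text \<open>Any product of two or more of the perturbations carries \<open>p^4\<close>.\<close>

lemma prod_one_plus_p2_cg:
  assumes "finite A" "\<And>i. i \<in> A \<Longrightarrow> y i \<in> Zp"
  shows "cg 4 (\<Prod>i\<in>A. 1 + of_nat p ^ 2 * y i) (1 + of_nat p ^ 2 * (\<Sum>i\<in>A. y i))"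
  using assms
proof (induction A rule: finite_induct)
  case (insert a A)
  have SZ: "(\<Sum>i\<in>A. y i) \<in> Zp" "y a \<in> Zp" using insert by auto
  have "cg 4 ((1 + of_nat p ^ 2 * y a) * (\<Prod>i\<in>A. 1 + of_nat p ^ 2 * y i))
     ((1 + of_nat p ^ 2 * y a) * (1 + of_nat p ^ 2 * (\<Sum>i\<in>A. y i)))"
    using insert by (intro cg_mult cg_refl insert.IH Zp_intros SZ) auto
  also have "cg 4 \<dots> (1 + of_nat p ^ 2 * (y a + (\<Sum>i\<in>A. y i)))"
    by (rule cgI[of "y a * (\<Sum>i\<in>A. y i)"])
      (use SZ in \<open>auto simp: algebra_simps eval_nat_numeral\<close>)
  finally show ?case using insert by simp
qed simp

definition B :: rat where "B = bernoulli (p - 3)"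

lemma B_Zp: "B \<in> Zp" unfolding B_def using p_ge_5 by (intro bernoulli_Zp) simp

definition block_prod :: "nat \<Rightarrow> rat" where "block_prod N = (\<Prod>i=1..p-1. of_nat (N * p + i))"

lemma block_prod_Up: "block_prod N \<in> Up"
  unfolding block_prod_def
proof (intro Up_prod Up_of_nat)
  fix i assume "i \<in> {1..p-1}"
  then have "\<not> p dvd i" by (auto dest: dvd_imp_le)
  then show "\<not> p dvd N * p + i" by (simp add: dvd_add_right_iff)
qed

text \<open>\<open>(N p + i) (N p + p - i) = i (p - i) + p^2 N (N + 1)\<close>, so \<open>N\<close>
  enters only at order \<open>p^2\<close>; the half-range sum of \<open>1 / (i (p - i))\<close>
  supplies a further \<open>p\<close>.\<close>

lemma block_prod_cg: "cg 4 (block_prod N) (block_prod 0 * (1 - of_nat p ^ 3 * (B / 3) * of_nat (N * (N + 1))))"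
proof -
  define S where "S = (\<Sum>i=1..h. 1 / (of_nat i * (of_nat p - of_nat i) :: rat))"
  have block_prod_eq: "block_prod N = (\<Prod>i=1..h. of_nat i * (of_nat p - of_nat i) + of_nat p ^ 2 * of_nat (N * (N + 1)))" for N
    unfolding block_prod_def prod_reflect_p
  proof (intro prod.cong refl)
    fix i assume "i \<in> {1..h}"
    then have "of_nat (N * p + (p - i)) = of_nat N * of_nat p + (of_nat p - of_nat i :: rat)"
      using le_h_less_p[of i] by (simp only: of_nat_add of_nat_mult of_nat_diff less_imp_le atLeastAtMost_iff)
    then show "of_nat (N * p + i) * of_nat (N * p + (p - i)) =
        of_nat i * (of_nat p - of_nat i) + of_nat p ^ 2 * (of_nat (N * (N + 1)) :: rat)"
      by (simp only: of_nat_add of_nat_mult of_nat_1) (simp add: algebra_simps power2_eq_square)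
  qed
  have u: "of_nat i * (of_nat p - of_nat i) \<in> Up" if "i \<in> {1..h}" for i
    using that p_h by (intro Up_mult Up_of_nat_less Up_diff) auto
  have "block_prod N = block_prod 0 * (\<Prod>i=1..h. 1 + of_nat p ^ 2 * (of_nat (N * (N + 1)) * (1 / (of_nat i * (of_nat p - of_nat i)))))"
    unfolding block_prod_eq prod.distrib[symmetric]
  proof (rule prod.cong)
    fix i assume i: "i \<in> {1..h}"
    \<comment> \<open>The term \<open>q * 0\<close> keeps the shape of \<open>block_prod_eq\<close>
      at \<open>N = 0\<close>, so \<open>block_prod 0\<close> splits off factor by factor.\<close>
    have factor: "x + q * a = (x + q * 0) * (1 + q * (a * (1 / x)))" if "x \<noteq> 0" for x q a :: rat
      using that by (simp add: algebra_simps)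
    show "of_nat i * (of_nat p - of_nat i) + of_nat p ^ 2 * of_nat (N * (N + 1)) =
        (of_nat i * (of_nat p - of_nat i) + of_nat p ^ 2 * of_nat (0 * (0 + 1))) *
        (1 + of_nat p ^ 2 * (of_nat (N * (N + 1)) * (1 / (of_nat i * (of_nat p - of_nat i) :: rat))))"
      unfolding mult_zero_left of_nat_0 using Up_nz[OF u[OF i]] by (rule factor)
  qed simp
  also have "cg 4 \<dots> (block_prod 0 * (1 + of_nat p ^ 2 * (\<Sum>i=1..h. of_nat (N * (N + 1)) * (1 / (of_nat i * (of_nat p - of_nat i))))))"
    by (intro cg_scale prod_one_plus_p2_cg Up_Zp[OF block_prod_Up] finite_atLeastAtMost
        Zp_mult Zp_divide u Zp_intros)
  also have "\<dots> = block_prod 0 * (1 + of_nat p ^ 2 * (of_nat (N * (N + 1)) * S))"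
    unfolding S_def sum_distrib_left ..
  also have "cg 4 \<dots> (block_prod 0 * (1 + of_nat p ^ 2 * (of_nat (N * (N + 1)) * (- (of_nat p * B) / 3))))"
  proof (rule cg_scale[OF cg_add[OF cg_refl] Up_Zp[OF block_prod_Up]])
    have "cg (2 + 2) (of_nat p ^ 2 * (of_nat (N * (N + 1)) * S)) (of_nat p ^ 2 * (of_nat (N * (N + 1)) * (- (of_nat p * B) / 3)))"
      unfolding cg_p_mult S_def B_def by (intro cg_scale reciprocal_products_cg Zp_of_nat)
    then show "cg 4 (of_nat p ^ 2 * (of_nat (N * (N + 1)) * S)) (of_nat p ^ 2 * (of_nat (N * (N + 1)) * (- (of_nat p * B) / 3)))"
      by simp
  qed
  also have "\<dots> = block_prod 0 * (1 - of_nat p ^ 3 * (B / 3) * of_nat (N * (N + 1)))"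
    by (simp add: eval_nat_numeral)
  finally show ?thesis .
qed

text \<open>Corrections \<open>1 + p^3 u\<close> multiply by adding the \<open>u\<close>, since
  \<open>p^6 u v\<close> vanishes modulo \<open>p^4\<close>.\<close>

lemma first_order_mult:
  assumes "cg 4 x (a * (1 + of_nat p ^ 3 * u))" "cg 4 y (b * (1 + of_nat p ^ 3 * v))"
    "a \<in> Zp" "b \<in> Zp" "u \<in> Zp" "v \<in> Zp"
  shows "cg 4 (x * y) ((a * b) * (1 + of_nat p ^ 3 * (u + v)))"
proof -
  have "cg 4 (x * y) ((a * (1 + of_nat p ^ 3 * u)) * (b * (1 + of_nat p ^ 3 * v)))"
    by (intro cg_mult Zp_intros assms)
  also have "cg 4 \<dots> ((a * b) * (1 + of_nat p ^ 3 * (u + v)))"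
    by (rule cgI[of "of_nat p ^ 2 * (a * b * u * v)"])
       ((intro Zp_intros assms)+, simp add: algebra_simps eval_nat_numeral)
  finally show ?thesis .
qed

lemma first_order_power:
  assumes "cg 4 x (a * (1 + of_nat p ^ 3 * u))" "a \<in> Zp" "u \<in> Zp"
  shows "cg 4 (x ^ n) (a ^ n * (1 + of_nat p ^ 3 * (of_nat n * u)))"
proof (induction n)
  case (Suc n)
  have "cg 4 (x * x ^ n) (a * a ^ n * (1 + of_nat p ^ 3 * (u + of_nat n * u)))"
    by (intro first_order_mult assms Suc Zp_intros)
  then show ?case by (simp add: algebra_simps)
qed simp

text \<open>The sum of \<open>N (N + 1)\<close> over \<open>N < n\<close> is
  \<open>(n^3 - n) / 3\<close>.\<close>

lemma prod_block_prod_cg: "cg 4 (\<Prod>N<n. block_prod N) (block_prod 0 ^ n * (1 + of_nat p ^ 3 * (- B / 9 * (of_nat n ^ 3 - of_nat n))))"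
proof (induction n)
  case (Suc n)
  have 9: "- B / 9 \<in> Zp" and 3: "- B / 3 \<in> Zp"
    using Zp_divide[OF Zp_uminus[OF B_Zp] Up_mult[OF Up_3 Up_3]] Zp_divide[OF Zp_uminus[OF B_Zp] Up_3] by simp_all
  have "cg 4 ((\<Prod>N<n. block_prod N) * block_prod n) (block_prod 0 ^ n * block_prod 0 * (1 + of_nat p ^ 3 *
     (- B / 9 * (of_nat n ^ 3 - of_nat n) + - B / 3 * of_nat (n * (n + 1)))))"
  proof (intro first_order_mult Suc 9 3 Zp_intros Up_Zp[OF block_prod_Up])
    show "cg 4 (block_prod n) (block_prod 0 * (1 + of_nat p ^ 3 * (- B / 3 * of_nat (n * (n + 1)))))"
      using block_prod_cg[of n] by (simp add: mult.assoc)
  qed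
  moreover have "- B / 9 * (of_nat n ^ 3 - of_nat n) + - B / 3 * of_nat (n * (n + 1)) = - B / 9 * (of_nat (Suc n) ^ 3 - of_nat (Suc n))"
  proof -
    define c where "c = - B / 9"
    have c3: "- B / 3 = 3 * c" by (simp add: c_def)
    show ?thesis unfolding c3 c_def[symmetric] by (simp add: algebra_simps eval_nat_numeral)
  qed
  ultimately show ?case by (simp add: mult_ac)
qed simp

text \<open>Powers of \<open>p\<close> cancel in the quotient of factorials, leaving the factor
  \<open>R n / (R j * R (n - j))\<close>. There the powers of \<open>block_prod 0\<close> cancel,
  and the corrections combine through \<open>n^3 - j^3 - (n - j)^3 = 3 n j (n - j)\<close>.\<close>

lemma binomial_mult_cg:
  assumes "j \<le> n"
  shows "cg 4 (of_nat (n * p choose (j * p)))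
    (of_nat (n choose j) * (1 + of_nat p ^ 3 * (- B / 3 * of_nat (n * j * (n - j)))))"
proof -
  define R where "R n = (\<Prod>N<n. block_prod N)" for n
  define v where "v n = - B / 9 * (of_nat n ^ 3 - of_nat n :: rat)" for n
  have RU: "R n \<in> Up" for n unfolding R_def by (intro Up_prod block_prod_Up)
  have 9: "- B / 9 \<in> Zp" and 3: "- B / 3 \<in> Zp"
    using Zp_divide[OF Zp_uminus[OF B_Zp] Up_mult[OF Up_3 Up_3]] Zp_divide[OF Zp_uminus[OF B_Zp] Up_3] by simp_all
  have vZ: "v n \<in> Zp" for n unfolding v_def by (intro Zp_intros 9)
  have Rv: "cg 4 (R n) (block_prod 0 ^ n * (1 + of_nat p ^ 3 * v n))" for n
    unfolding R_def v_def by (rule prod_block_prod_cg)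
  have fact: "fact (n * p) = of_nat p ^ n * fact n * R n" for n
    unfolding R_def block_prod_def by (rule fact_mult_prod) simp
  have jp: "j * p \<le> n * p" using assms by simp
  have npj: "n * p - j * p = (n - j) * p" by (simp add: diff_mult_distrib)
  have pn: "of_nat p ^ n = (of_nat p ^ j * of_nat p ^ (n - j) :: rat)"
    using assms by (simp add: power_add[symmetric])
  have cancel: "(a * b * x * r) / ((a * y * s) * (b * z * t)) = x / (y * z) * (r / (s * t))"
    if "a \<noteq> 0" "b \<noteq> 0" for a b x y z r s t :: rat
    using that by simp
  have "of_nat (n * p choose (j * p)) = (fact (n * p) / (fact (j * p) * fact ((n - j) * p)) :: rat)"
    unfolding binomial_fact[OF jp] npj ..
  also have "\<dots> = of_nat (n choose j) * (R n / (R j * R (n - j)))"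
    unfolding fact binomial_fact[OF assms]
    unfolding pn by (rule cancel) auto
  finally have eq: "of_nat (n * p choose (j * p)) * (R j * R (n - j)) = of_nat (n choose j) * R n"
    using Up_nz[OF RU] by simp
  define w where "w = - B / 3 * of_nat (n * j * (n - j))"
  have wZ: "w \<in> Zp" unfolding w_def by (intro Zp_intros 3)
  have vw: "v n = w + (v j + v (n - j))"
  proof -
    obtain k where k: "n = j + k" using assms le_Suc_ex by blast
    define c where "c = - B / 9"
    have c3: "- B / 3 = 3 * c" by (simp add: c_def)
    show ?thesis unfolding v_def w_def c3 c_def[symmetric] k
      by (simp add: algebra_simps eval_nat_numeral)
  qed
  \<comment> \<open>Starts from the claimed right-hand side times the unit
    \<open>R j * R (n - j)\<close>, so that no quotient has to be expanded.\<close>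
  have "cg 4 ((of_nat (n choose j) * (1 + of_nat p ^ 3 * w)) * (R j * R (n - j)))
     (of_nat (n choose j) * (block_prod 0 ^ j * block_prod 0 ^ (n - j)) * (1 + of_nat p ^ 3 * (w + (v j + v (n - j)))))"
    by (intro first_order_mult Rv cg_refl vZ wZ Zp_intros Up_Zp[OF block_prod_Up])
  also have "\<dots> = of_nat (n choose j) * (block_prod 0 ^ n * (1 + of_nat p ^ 3 * v n))"
    unfolding vw power_add[symmetric] using assms by simp
  also have "cg 4 \<dots> (of_nat (n choose j) * R n)"
    by (intro cg_scale cg_sym[OF Rv] Zp_of_nat)
  finally have "cg 4 ((R j * R (n - j)) * of_nat (n * p choose (j * p))) ((R j * R (n - j)) * (of_nat (n choose j) * (1 + of_nat p ^ 3 * w)))"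
    unfolding eq[symmetric] by (metis cg_sym mult.commute)
  then show ?thesis unfolding w_def using Up_mult[OF RU RU] by (rule cg_cancel)
qed

end

section \<open>Summands at indices prime to the prime\<close>

lemma sum_blocks:
  fixes t :: "nat \<Rightarrow> 'a::comm_monoid_add"
  assumes "p > 0"
  shows "(\<Sum>k=0..n*p. t k) = (\<Sum>j=0..n. t (j * p)) + (\<Sum>j<n. \<Sum>i=1..p-1. t (j * p + i))"
proof (induction n)
  case (Suc n)
  have "(\<Sum>k=0..m+q. t k) = (\<Sum>k=0..m. t k) + (\<Sum>i=1..q. t (m + i))" for m q
    by (induction q) (simp_all add: add_ac)
  from this[of "n * p" p] have "(\<Sum>k=0..Suc n*p. t k) = (\<Sum>k=0..n*p. t k) + (\<Sum>i=1..p. t (n * p + i))"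
    by (simp add: add.commute)
  also have "(\<Sum>i=1..p. t (n * p + i)) = (\<Sum>i=1..p-1. t (n * p + i)) + t (Suc n * p)"
    using assms by (cases p) (simp_all add: add_ac)
  finally show ?case by (simp add: Suc add_ac)
qed simp

text \<open>Iterates the ratio of neighbouring binomial coefficients, cleared of
  denominators.\<close>

lemma binomial_add_prod:
  assumes "a + i \<le> M"
  shows "(of_nat (M choose (a + i)) :: 'a :: comm_ring_1) * (\<Prod>l=1..i. of_nat (a + l)) =
    of_nat (M choose a) * (\<Prod>l<i. of_nat M - of_nat a - of_nat l)"
  using assms
proof (induction i)
  case (Suc i)
  have "Suc (a + i) * (M choose Suc (a + i)) = (M - (a + i)) * (M choose (a + i))"
    unfolding binomial_absorption binomial_absorb_comp ..
  then have "of_nat (Suc (a + i)) * of_nat (M choose Suc (a + i)) = (of_nat (M - (a + i)) * of_nat (M choose (a + i)) :: 'a)"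
    by (simp only: of_nat_mult[symmetric])
  also have "of_nat (M - (a + i)) = (of_nat M - of_nat a - of_nat i :: 'a)"
    using Suc.prems by (simp add: of_nat_diff)
  finally have step: "of_nat (Suc (a + i)) * of_nat (M choose Suc (a + i)) = ((of_nat M - of_nat a - of_nat i) * of_nat (M choose (a + i)) :: 'a)" .
  have "(of_nat (M choose (a + Suc i)) :: 'a) * (\<Prod>l=1..Suc i. of_nat (a + l)) =
     (of_nat (Suc (a + i)) * of_nat (M choose Suc (a + i))) * (\<Prod>l=1..i. of_nat (a + l))"
    by (simp add: mult_ac add_ac)
  also have "\<dots> = (of_nat M - of_nat a - of_nat i) * (of_nat (M choose (a + i)) * (\<Prod>l=1..i. of_nat (a + l)))"
    unfolding step by (simp only: mult_ac)
  also have "\<dots> = of_nat (M choose a) * (\<Prod>l<Suc i. of_nat M - of_nat a - of_nat l)"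
    using Suc by (simp add: mult_ac)
  finally show ?case .
qed simp

lemma fact_diff_prod:
  assumes "i \<le> a"
  shows "(fact a :: 'a :: {semiring_char_0, comm_ring_1}) = fact (a - i) * (\<Prod>l<i. of_nat a - of_nat l)"
  using assms
proof (induction i)
  case (Suc i)
  then have "a - i = Suc (a - Suc i)" by simp
  then have "(fact (a - i) :: 'a) = of_nat (a - i) * fact (a - Suc i)"
    by (metis fact_Suc)
  then show ?case using Suc by (simp add: of_nat_diff mult_ac)
qed simp

section \<open>Central binomial coefficients and the correction sum\<close>

abbreviation cb :: "nat \<Rightarrow> nat" where "cb k \<equiv> 2 * k choose k"

lemma cb_fact: "of_nat (cb m) * (fact m * fact m) = (fact (2 * m) :: rat)"
  by (simp add: binomial_fact mult_2)

lemma cb_Suc: "of_nat (Suc m) * of_nat (cb (Suc m)) = (2 * of_nat (2 * m + 1) * of_nat (cb m) :: rat)"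
proof -
  have f: "fact (2 * Suc m) = of_nat (2 * Suc m) * (of_nat (2 * m + 1) * (fact (2 * m) :: rat))"
    by (simp add: algebra_simps)
  have "of_nat (cb (Suc m)) * ((of_nat (Suc m) * fact m) * (of_nat (Suc m) * fact m)) =
      (2 * of_nat (Suc m)) * (of_nat (2 * m + 1) * (of_nat (cb m) * (fact m * fact m :: rat)))"
    using cb_fact[of "Suc m"] unfolding f cb_fact[of m] fact_Suc of_nat_mult by (simp only: of_nat_numeral)
  then have "(of_nat (Suc m) * of_nat (cb (Suc m))) * (of_nat (Suc m) * (fact m * fact m)) =
      (2 * of_nat (2 * m + 1) * of_nat (cb m)) * (of_nat (Suc m) * (fact m * fact m :: rat))"
    by (simp only: mult_ac)
  moreover have "of_nat (Suc m) * (fact m * fact m :: rat) \<noteq> 0" by (simp del: of_nat_Suc)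
  ultimately show ?thesis using mult_right_cancel by blast
qed

text \<open>
  The summands differ by a factor \<open>m - 2 j\<close> times an expression invariant under \<open>j \<mapsto> m - j\<close>, so the two
  sums agree although the summands do not.
\<close>

lemma sum_domb_correction:
  "4 * (\<Sum>j<Suc m. of_nat (Suc m choose j) ^ 2 * of_nat (Suc m - j) ^ 3 * of_nat (cb j) * of_nat (cb (Suc m - j))) =
   8 * (\<Sum>j<Suc m. of_nat (Suc m choose j) ^ 2 * of_nat (cb j) * of_nat (cb (m - j)) * of_nat (Suc m) * of_nat (Suc m - j) ^ 2 :: rat)"
proof -
  define n where "n = (of_nat (Suc m) :: rat)"
  define g where "g j = of_nat (m choose j) ^ 2 * of_nat (cb j) * (of_nat (cb (m - j)) :: rat)" for j
  have absorb: "of_nat (Suc m choose j) * of_nat (Suc m - j) = n * (of_nat (m choose j) :: rat)" for j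
    using binomial_absorb_comp[of "Suc m" j] unfolding n_def
    by (metis diff_Suc_1 mult.commute of_nat_mult)
  have "(\<Sum>j<Suc m. g j * (of_nat m - 2 * of_nat j)) = (\<Sum>j<Suc m. g (Suc m - Suc j) * (of_nat m - 2 * of_nat (Suc m - Suc j)))"
    by (rule sum.nat_diff_reindex[symmetric])
  also have "\<dots> = (\<Sum>j<Suc m. - (g j * (of_nat m - 2 * of_nat j)))"
  proof (rule sum.cong)
    fix j assume "j \<in> {..<Suc m}"
    then have j: "j \<le> m" by simp
    have "g (m - j) = g j" unfolding g_def using j by (simp add: binomial_symmetric[of j m] mult_ac)
    then show "g (Suc m - Suc j) * (of_nat m - 2 * of_nat (Suc m - Suc j)) = - (g j * (of_nat m - 2 * of_nat j))"
      using j by (simp add: of_nat_diff algebra_simps)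
  qed simp
  finally have zero: "(\<Sum>j<Suc m. g j * (of_nat m - 2 * of_nat j)) = 0"
    unfolding sum_negf by simp
  \<comment> \<open>Two of the three factors \<open>Suc m - j\<close> are absorbed by the squared
    binomial coefficient, the third by \<open>cb_Suc\<close>. Then
    \<open>2 (m - j) + 1 = (m - 2 j) + n\<close> splits off the part that sums to zero.\<close>
  have l: "4 * (of_nat (Suc m choose j) ^ 2 * of_nat (Suc m - j) ^ 3 * of_nat (cb j) * of_nat (cb (Suc m - j)))
     = 8 * n ^ 2 * (g j * (of_nat m - 2 * of_nat j)) + 8 * n ^ 3 * g j" if "j < Suc m" for j
  proof -
    have S: "Suc m - j = Suc (m - j)" using that by simp
    have "4 * (of_nat (Suc m choose j) ^ 2 * of_nat (Suc m - j) ^ 3 * of_nat (cb j) * of_nat (cb (Suc m - j)))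
      = 4 * (of_nat (Suc m choose j) * of_nat (Suc m - j)) ^ 2 * of_nat (cb j) * (of_nat (Suc m - j) * (of_nat (cb (Suc m - j)) :: rat))"
      by (simp only: power_mult_distrib power2_eq_square power3_eq_cube mult_ac)
    also have "\<dots> = 4 * (n * of_nat (m choose j)) ^ 2 * of_nat (cb j) * (2 * of_nat (2 * (m - j) + 1) * of_nat (cb (m - j)))"
      unfolding absorb unfolding S cb_Suc ..
    also have "\<dots> = 8 * n ^ 2 * g j * of_nat (2 * (m - j) + 1)"
      unfolding g_def power_mult_distrib by simp
    also have "of_nat (2 * (m - j) + 1) = (of_nat m - 2 * of_nat j) + n"
      using that unfolding n_def by (simp add: of_nat_diff)
    finally show ?thesis by (simp add: algebra_simps eval_nat_numeral)
  qed
  have r: "8 * (of_nat (Suc m choose j) ^ 2 * of_nat (cb j) * of_nat (cb (m - j)) * of_nat (Suc m) * of_nat (Suc m - j) ^ 2) = 8 * n ^ 3 * g j" for j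
  proof -
    have "8 * (of_nat (Suc m choose j) ^ 2 * of_nat (cb j) * of_nat (cb (m - j)) * of_nat (Suc m) * of_nat (Suc m - j) ^ 2) =
      8 * (of_nat (Suc m choose j) * of_nat (Suc m - j)) ^ 2 * of_nat (cb j) * of_nat (cb (m - j)) * n"
      unfolding n_def by (simp only: power_mult_distrib mult_ac)
    also have "\<dots> = 8 * n ^ 3 * g j"
      unfolding absorb g_def by (simp only: power_mult_distrib power2_eq_square power3_eq_cube mult_ac)
    finally show ?thesis .
  qed
  have "4 * (\<Sum>j<Suc m. of_nat (Suc m choose j) ^ 2 * of_nat (Suc m - j) ^ 3 * of_nat (cb j) * of_nat (cb (Suc m - j))) =
     (\<Sum>j<Suc m. 8 * n ^ 2 * (g j * (of_nat m - 2 * of_nat j)) + 8 * n ^ 3 * g j)"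
    unfolding sum_distrib_left by (intro sum.cong refl l) simp
  also have "\<dots> = 8 * n ^ 2 * (\<Sum>j<Suc m. g j * (of_nat m - 2 * of_nat j)) + (\<Sum>j<Suc m. 8 * n ^ 3 * g j)"
    unfolding sum.distrib sum_distrib_left ..
  finally show ?thesis unfolding zero sum_distrib_left[of 8] r by simp
qed

context rat_localization_ge5
begin

section \<open>Binomial coefficients near multiples of the prime\<close>

definition rising :: "nat \<Rightarrow> nat \<Rightarrow> rat" where "rising a i = (\<Prod>l=1..i. of_nat (a + l))"

text \<open>The factor \<open>N p\<close> for \<open>l = 0\<close> is left out: for
  \<open>i <= p\<close> all the others are units.\<close>

definition falling :: "nat \<Rightarrow> nat \<Rightarrow> rat" where "falling N i = (\<Prod>l=1..i-1. of_nat (N * p) - of_nat l)"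

lemma prod_falling: "i > 0 \<Longrightarrow> (\<Prod>l<i. of_nat (N * p) - of_nat l) = of_nat (N * p) * falling N i"
proof -
  assume "i > 0"
  then have "{..<i} = insert 0 {1..i-1}" by auto
  then show ?thesis unfolding falling_def by simp
qed

lemma rising_Up: "i < p \<Longrightarrow> rising (j * p) i \<in> Up"
  unfolding rising_def
proof (intro Up_prod Up_of_nat)
  fix l assume "i < p" "l \<in> {1..i}"
  then have "\<not> p dvd l" by (auto dest: dvd_imp_le)
  then show "\<not> p dvd j * p + l" by (simp add: dvd_add_right_iff)
qed

lemma rising_cg: "cg 1 (rising (j * p) i) (fact i)"
  unfolding rising_def fact_prod of_nat_prod
  by (intro cg_prod Zp_of_nat cgI[of "of_nat j"]) simp_all

lemma falling_cg: "cg 1 (falling N i) ((- 1) ^ (i - 1) * fact (i - 1))"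
proof -
  have "cg 1 (falling N i) (\<Prod>l=1..i-1. - of_nat l)"
    unfolding falling_def by (intro cg_prod Zp_intros cgI[of "of_nat N"]) simp_all
  also have "(\<Prod>l=1..i-1. - of_nat l :: rat) = (- 1) ^ (i - 1) * fact (i - 1)"
    unfolding fact_prod of_nat_prod by (simp add: prod_uminus)
  finally show ?thesis .
qed

lemma falling_Up: "i \<le> p \<Longrightarrow> falling N i \<in> Up"
  unfolding falling_def
proof (intro Up_prod)
  fix l assume l: "i \<le> p" "l \<in> {1..i-1}"
  show "of_nat (N * p) - of_nat l \<in> Up"
  proof (cases "N = 0")
    case True
    then show ?thesis using l by (auto intro!: Up_uminus Up_of_nat_less)
  next
    case False
    have "l \<le> N * p" using l False by (cases N) auto
    moreover have "\<not> p dvd l" using l by (auto dest: dvd_imp_le)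
    ultimately have "\<not> p dvd N * p - l" by (metis dvd_diffD dvd_triv_right dvd_minus_self dvd_diff_nat diff_diff_cancel)
    from Up_of_nat[OF this] show ?thesis using \<open>l \<le> N * p\<close> by (simp only: of_nat_diff)
  qed
qed

lemma binomial_mult_cg1:
  assumes "j \<le> n" shows "cg 1 (of_nat (n * p choose (j * p))) (of_nat (n choose j))"
proof -
  have 3: "- B / 3 \<in> Zp" using Zp_divide[OF Zp_uminus[OF B_Zp] Up_3] .
  have "cg 1 (of_nat (n * p choose (j * p))) (of_nat (n choose j) * (1 + of_nat p ^ 3 * (- B / 3 * of_nat (n * j * (n - j)))))"
    using binomial_mult_cg[OF assms] by (rule cg_mono) simp
  also have "cg 1 \<dots> (of_nat (n choose j))"
    by (rule cgI[of "of_nat (n choose j) * of_nat p ^ 2 * (- B / 3 * of_nat (n * j * (n - j)))"])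
      ((intro Zp_intros 3)+, simp add: algebra_simps eval_nat_numeral)
  finally show ?thesis .
qed

text \<open>Climbing from \<open>j p\<close> to \<open>j p + i\<close> divides by units and
  multiplies by \<open>(n - j) p\<close> and further units. The explicit \<open>p\<close> is pulled
  out and the rest reduced modulo \<open>p\<close>.\<close>

lemma binomial_nonmult:
  assumes "j < n" "1 \<le> i" "i < p"
  obtains z where "of_nat (n * p choose (j * p + i)) = of_nat p * z" "z \<in> Zp"
    "cg 1 z (of_nat (n choose j) * of_nat (n - j) * ((- 1) ^ (i - 1) * fact (i - 1)) / fact i)"
proof -
  define z where "z = of_nat (n * p choose (j * p)) * of_nat (n - j) * falling (n - j) i / rising (j * p) i"
  have "Suc j * p \<le> n * p" using assms by (intro mult_right_mono) auto
  then have le: "j * p + i \<le> n * p" using assms by simp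
  have "of_nat (n * p) - of_nat (j * p) = (of_nat ((n - j) * p) :: rat)"
    using assms by (simp add: of_nat_diff algebra_simps)
  then have "of_nat (n * p choose (j * p + i)) * rising (j * p) i = of_nat (n * p choose (j * p)) * (of_nat ((n - j) * p) * falling (n - j) i)"
    using binomial_add_prod[OF le, where ?'a = rat] prod_falling[of i "n - j"] assms unfolding rising_def by simp
  then have "of_nat (n * p choose (j * p + i)) = of_nat p * z"
    unfolding z_def using Up_nz[OF rising_Up[OF assms(3)], of j] by (simp add: field_simps)
  moreover have z: "cg 1 z (of_nat (n choose j) * of_nat (n - j) * ((- 1) ^ (i - 1) * fact (i - 1)) / fact i)"
    unfolding z_def using assms
    by (intro cg_divide cg_mult binomial_mult_cg1 cg_refl falling_cg rising_cg rising_Up Up_fact Zp_intros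
        Up_Zp[OF Up_uminus[OF Up_1]] Up_Zp[OF Up_fact]) auto
  moreover have "z \<in> Zp"
    unfolding z_def using assms by (intro Zp_divide Zp_mult Zp_of_nat Up_Zp[OF falling_Up] rising_Up) auto
  ultimately show ?thesis using that by blast
qed

lemma cb_mult_cg1: "cg 1 (of_nat (cb (j * p))) (of_nat (cb j))"
  using binomial_mult_cg1[of j "2 * j"] by (simp add: mult.assoc)

text \<open>By \<open>2 i < p\<close>, no multiple of \<open>p\<close> lies among
  \<open>j p + 1, ..., j p + i\<close> or \<open>2 j p + 1, ..., 2 j p + 2 i\<close>, so the
  factorials change by units only.\<close>

lemma cb_add_cg:
  assumes "1 \<le> i" "2 * i < p"
  shows "cg 1 (of_nat (cb (j * p + i))) (of_nat (cb j) * fact (2 * i) / (fact i * fact i))"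
proof -
  have f: "fact (j * p + i) = fact (j * p) * rising (j * p) i" 
    and f2: "fact (2 * (j * p + i)) = fact (2 * (j * p)) * rising (2 * j * p) (2 * i)"
    unfolding rising_def using fact_add_prod[of "j * p" i, where ?'a = rat] fact_add_prod[of "2 * j * p" "2 * i", where ?'a = rat]
    by (simp_all add: mult.assoc distrib_left)
  have nz: "rising (j * p) i \<noteq> 0" using Up_nz[OF rising_Up] assms by simp
  have "(of_nat (cb (j * p + i)) * (rising (j * p) i * rising (j * p) i)) * (fact (j * p) * fact (j * p)) =
    (of_nat (cb (j * p)) * rising (2 * j * p) (2 * i)) * (fact (j * p) * fact (j * p))"
  proof -
    have "(X * (v * v)) * (F * F) = (A * w) * (F * F)"
      if "X * ((F * v) * (F * v)) = G * w" "A * (F * F) = G" for X v w F A G :: rat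
      using that(1) unfolding that(2)[symmetric] by (simp only: mult_ac)
    from this[OF cb_fact[of "j * p + i", unfolded f f2] cb_fact[of "j * p"]] show ?thesis .
  qed
  then have "of_nat (cb (j * p + i)) = of_nat (cb (j * p)) * rising (2 * j * p) (2 * i) / (rising (j * p) i * rising (j * p) i)"
    using nz by (simp add: field_simps)
  also have "cg 1 \<dots> (of_nat (cb j) * fact (2 * i) / (fact i * fact i))"
    using assms unfolding mult.assoc[of 2 j p]
    by (intro cg_divide cg_mult cb_mult_cg1 rising_cg[of "2 * j", unfolded mult.assoc] rising_cg rising_Up
        Up_mult Up_fact Up_Zp[OF Up_fact] Zp_mult Zp_of_nat) auto
  finally show ?thesis .
qed

text \<open>Descending from \<open>N p\<close> removes \<open>N p\<close> twice from the squared
  factorial in the denominator but \<open>2 N p\<close> only once from the numerator, which leaves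
  one factor \<open>p\<close> on top.\<close>

lemma cb_diff:
  assumes "1 \<le> N" "1 \<le> i" "i \<le> h"
  obtains w where "of_nat (cb (N * p - i)) = of_nat p * w" "w \<in> Zp"
    "cg 1 w (- of_nat (cb N) * of_nat N * (fact (i - 1) * fact (i - 1)) / (2 * fact (2 * i - 1)))"
proof -
  define w where "w = of_nat (cb (N * p)) * of_nat N * (falling N i * falling N i) / (2 * falling (2 * N) (2 * i))"
  have ip: "2 * i < p" using assms p_h by simp
  have "1 * p \<le> N * p" using assms by (intro mult_right_mono) auto
  then have le: "i \<le> N * p" using ip by linarith
  have f: "fact (N * p) = fact (N * p - i) * (of_nat (N * p) * falling N i)"
    using fact_diff_prod[OF le, where ?'a = rat] prod_falling[of i N] assms by simp
  have "fact (2 * (N * p)) = fact (2 * (N * p - i)) * (of_nat (2 * N * p) * falling (2 * N) (2 * i))"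
    using fact_diff_prod[of "2 * i" "2 * N * p", where ?'a = rat] prod_falling[of "2 * i" "2 * N"] assms le
    by (simp add: mult.assoc right_diff_distrib')
  moreover have "of_nat (2 * N * p) = (2 * of_nat (N * p) :: rat)" by simp
  ultimately have f2: "fact (2 * (N * p)) = fact (2 * (N * p - i)) * ((2 * of_nat (N * p)) * falling (2 * N) (2 * i))"
    by (simp only:)
  have nz: "falling (2 * N) (2 * i) \<noteq> 0" using Up_nz falling_Up ip by simp
  have "(of_nat (cb (N * p - i)) * (2 * falling (2 * N) (2 * i))) * (of_nat (N * p) * (fact (N * p - i) * fact (N * p - i)))
     = (of_nat (N * p) * of_nat (cb (N * p)) * (falling N i * falling N i)) * (of_nat (N * p) * (fact (N * p - i) * fact (N * p - i)))"
  proof -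
    have "(X * (2 * v')) * (M * (F * F)) = (M * A * (v * v)) * (M * (F * F))"
      if "A * ((F * (M * v)) * (F * (M * v))) = G * ((2 * M) * v')" "X * (F * F) = G" for A F G M X v v' :: rat
    proof -
      have "(X * (2 * v')) * (M * (F * F)) = (X * (F * F)) * ((2 * M) * v')" by (simp only: mult_ac)
      also have "\<dots> = A * ((F * (M * v)) * (F * (M * v)))" unfolding that ..
      also have "\<dots> = (M * A * (v * v)) * (M * (F * F))" by (simp only: mult_ac)
      finally show ?thesis .
    qed
    from this[OF cb_fact[of "N * p", unfolded f f2] cb_fact[of "N * p - i"]] show ?thesis .
  qed
  moreover have "of_nat (N * p) * (fact (N * p - i) * fact (N * p - i)) \<noteq> (0 :: rat)"
    using assms by simp
  ultimately have "of_nat (cb (N * p - i)) * (2 * falling (2 * N) (2 * i)) = of_nat (N * p) * of_nat (cb (N * p)) * (falling N i * falling N i)"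
    using mult_right_cancel by blast
  then have 1: "of_nat (cb (N * p - i)) = of_nat p * w"
    unfolding w_def using nz by (simp add: field_simps)
  have U: "2 * falling (2 * N) (2 * i) \<in> Up" using ip by (intro Up_mult Up_2 falling_Up) auto
  have 2: "w \<in> Zp"
    unfolding w_def using ip by (intro Zp_divide Zp_mult Zp_of_nat Up_Zp[OF falling_Up] U) auto
  \<comment> \<open>The sign \<open>(-1)^(i-1)\<close> occurs squared on top, while the sign
    \<open>(-1)^(2 i - 1)\<close> below is \<open>-1\<close>; hence the minus in the result.\<close>
  let ?e = "(- 1) ^ (i - 1) :: rat"
  have ee: "?e * ?e = 1" by (simp flip: power_mult_distrib)
  have oe: "(- 1) ^ (2 * i - 1) = (- 1 :: rat)" using assms by (simp add: power_minus_odd)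
  have eZ: "(- 1) ^ m \<in> Zp" for m by (intro Zp_power Zp_uminus Zp_numeral)
  have "cg 1 w (of_nat (cb N) * of_nat N * ((?e * fact (i - 1)) * (?e * fact (i - 1))) / (2 * ((- 1) ^ (2 * i - 1) * fact (2 * i - 1))))"
    unfolding w_def using ip
    by (intro cg_divide cg_mult cb_mult_cg1 cg_refl falling_cg U Up_mult Up_2 Up_power Up_uminus Up_1 Up_fact
       Zp_mult Zp_of_nat eZ Up_Zp[OF Up_fact] Zp_numeral) auto
  also have "\<dots> = - of_nat (cb N) * of_nat N * (fact (i - 1) * fact (i - 1)) / (2 * fact (2 * i - 1))"
  proof -
    have "(?e * fact (i - 1)) * (?e * fact (i - 1)) = fact (i - 1) * (fact (i - 1) :: rat)"
    proof -
      have "(?e * fact (i - 1)) * (?e * fact (i - 1)) = (?e * ?e) * (fact (i - 1) * fact (i - 1))"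
        by (simp only: mult_ac)
      then show ?thesis unfolding ee by simp
    qed
    then show ?thesis unfolding oe by simp
  qed
  finally show ?thesis using that 1 2 by blast
qed

section \<open>Residues of the summands\<close>

definition D_summand :: "nat \<Rightarrow> nat \<Rightarrow> nat \<Rightarrow> nat \<Rightarrow> rat" where
  "D_summand r s n k = of_nat (n choose k) ^ r * (of_nat (cb k) * of_nat (cb (n - k))) ^ s"

lemma D_eq_sum_D_summand: "of_nat (D r s n) = (\<Sum>k=0..n. D_summand r s n k)"
  unfolding D_def D_summand_def by (simp add: right_diff_distrib')

lemma D_summand_sym: "k \<le> n \<Longrightarrow> D_summand r s n (n - k) = D_summand r s n k"
  unfolding D_summand_def by (simp add: binomial_symmetric[of k n] mult.commute)

text \<open>Each of the \<open>r\<close> binomial coefficients and each of the \<open>s\<close>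
  copies of \<open>cb (n p - k)\<close> yields one \<open>p\<close>. The residue is given for
  \<open>z^2\<close>, where the sign \<open>(-1)^(i-1)\<close> disappears; the factorials collapse
  to powers of \<open>i\<close>.\<close>

lemma D_summand_nonmult:
  assumes "j < n" "1 \<le> i" "i \<le> h"
  obtains z y where "D_summand r s (n * p) (j * p + i) = of_nat p ^ (r + s) * (z ^ r * y ^ s)"
    "z \<in> Zp" "y \<in> Zp" "cg 1 (z ^ 2) (of_nat (n choose j) ^ 2 * of_nat (n - j) ^ 2 / of_nat i ^ 2)"
    "cg 1 y (- of_nat (cb j) * of_nat (cb (n - j)) * of_nat (n - j) / of_nat i)"
proof -
  have ip: "2 * i < p" "i < p" using assms p_h by simp_all
  have fi: "fact i = of_nat i * (fact (i - 1) :: rat)" "fact (2 * i) = of_nat (2 * i) * (fact (2 * i - 1) :: rat)"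
    using assms by (simp_all add: fact_reduce)
  have fU: "fact i \<in> Up" "of_nat i \<in> Up" "2 * fact (2 * i - 1) \<in> Up" "2 \<in> Up" "fact (2 * i - 1) \<in> Up"
    using ip assms by (auto intro!: Up_fact Up_of_nat_less Up_mult Up_2)
  obtain z where z: "of_nat (n * p choose (j * p + i)) = of_nat p * z" "z \<in> Zp"
    "cg 1 z (of_nat (n choose j) * of_nat (n - j) * ((- 1) ^ (i - 1) * fact (i - 1)) / fact i)"
    using binomial_nonmult[OF assms(1,2) ip(2)] by blast
  have nj: "1 \<le> n - j" using assms by simp
  obtain w where w: "of_nat (cb ((n - j) * p - i)) = of_nat p * w" "w \<in> Zp"
    "cg 1 w (- of_nat (cb (n - j)) * of_nat (n - j) * (fact (i - 1) * fact (i - 1)) / (2 * fact (2 * i - 1)))"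
    using cb_diff[OF nj assms(2,3)] by blast
  define y where "y = of_nat (cb (j * p + i)) * w"
  have eq: "n * p - (j * p + i) = (n - j) * p - i" by (simp add: diff_mult_distrib)
  have "D_summand r s (n * p) (j * p + i) = (of_nat p * z) ^ r * (of_nat p * y) ^ s"
    unfolding D_summand_def eq z(1) w(1) y_def by (simp add: mult_ac)
  then have 1: "D_summand r s (n * p) (j * p + i) = of_nat p ^ (r + s) * (z ^ r * y ^ s)"
    by (simp add: power_mult_distrib power_add mult_ac)
  have 2: "y \<in> Zp" unfolding y_def using w by auto
  have zZ: "of_nat (n choose j) * of_nat (n - j) * ((- 1) ^ (i - 1) * fact (i - 1)) / fact i \<in> Zp"
    using ip by (intro Zp_divide Zp_mult Zp_of_nat Zp_power Zp_uminus Zp_numeral fU Up_Zp[OF Up_fact]) auto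
  have "cg 1 (z ^ 2) ((of_nat (n choose j) * of_nat (n - j) * ((- 1) ^ (i - 1) * fact (i - 1)) / fact i) ^ 2)"
    by (intro cg_power z zZ)
  also have "(of_nat (n choose j) * of_nat (n - j) * ((- 1) ^ (i - 1) * fact (i - 1)) / fact i) ^ 2 
      = (of_nat (n choose j) ^ 2 * of_nat (n - j) ^ 2 / of_nat i ^ 2 :: rat)"
    unfolding fi by (simp add: power_mult_distrib power_divide flip: power_mult)
  finally have 3: "cg 1 (z ^ 2) (of_nat (n choose j) ^ 2 * of_nat (n - j) ^ 2 / of_nat i ^ 2)" .
  have wZ: "- of_nat (cb (n - j)) * of_nat (n - j) * (fact (i - 1) * fact (i - 1)) / (2 * fact (2 * i - 1)) \<in> Zp"
    using ip by (intro Zp_divide Zp_mult Zp_of_nat Zp_uminus fU Up_Zp[OF Up_fact]) auto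
  have f2Z: "fact (2 * i) \<in> Zp" using ip by (intro Up_Zp Up_fact)
  have "cg 1 y ((of_nat (cb j) * fact (2 * i) / (fact i * fact i)) *
     (- of_nat (cb (n - j)) * of_nat (n - j) * (fact (i - 1) * fact (i - 1)) / (2 * fact (2 * i - 1))))"
    unfolding y_def by (intro cg_mult cb_add_cg assms ip w wZ Zp_divide Zp_mult Zp_of_nat f2Z Up_mult fU)
  also have "\<dots> = - of_nat (cb j) * of_nat (cb (n - j)) * of_nat (n - j) / of_nat i"
    unfolding fi using Up_nz[OF fU(2)] by (simp add: field_simps)
  finally show ?thesis using that 1 2 3 z(2) by blast
qed

lemma D_summand_mult_cg:
  assumes "j \<le> n"
  shows "cg 4 (D_summand r s (n * p) (j * p)) (D_summand r s n j * (1 + of_nat p ^ 3 *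
    (- B / 3 * of_nat (r * n * j * (n - j) + 2 * s * j ^ 3 + 2 * s * (n - j) ^ 3))))"
proof -
  have 3: "- B / 3 \<in> Zp" using Zp_divide[OF Zp_uminus[OF B_Zp] Up_3] .
  \<comment> \<open>Choosing \<open>k\<close> out of \<open>2 k\<close> turns
    \<open>n j (n - j)\<close> into \<open>2 k^3\<close>.\<close>
  have cb: "cg 4 (of_nat (cb (k * p))) (of_nat (cb k) * (1 + of_nat p ^ 3 * (- B / 3 * of_nat (2 * k ^ 3))))" for k
    using binomial_mult_cg[of k "2 * k"] by (simp add: mult.assoc power3_eq_cube)
  have eq: "n * p - j * p = (n - j) * p" by (simp add: diff_mult_distrib)
  have "cg 4 (D_summand r s (n * p) (j * p)) (D_summand r s n j * (1 + of_nat p ^ 3 *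
    (of_nat r * (- B / 3 * of_nat (n * j * (n - j))) + of_nat s * (- B / 3 * of_nat (2 * j ^ 3) + - B / 3 * of_nat (2 * (n - j) ^ 3)))))"
    unfolding D_summand_def eq
    by (intro first_order_mult first_order_power cb binomial_mult_cg assms Zp_intros 3)
  moreover have "of_nat r * (- B / 3 * of_nat (n * j * (n - j))) + of_nat s * (- B / 3 * of_nat (2 * j ^ 3) + - B / 3 * of_nat (2 * (n - j) ^ 3))
    = - B / 3 * of_nat (r * n * j * (n - j) + 2 * s * j ^ 3 + 2 * s * (n - j) ^ 3)"
    by (simp only: of_nat_add of_nat_mult of_nat_power of_nat_numeral) (simp only: algebra_simps)
  ultimately show ?thesis by (simp only:)
qed

text \<open>The symmetry \<open>k -> n p - k\<close> sends residue \<open>p - i\<close> in block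
  \<open>j\<close> to residue \<open>i\<close> in block \<open>n - 1 - j\<close>, which reduces to
  the range \<open>i <= h\<close> of \<open>D_summand_nonmult\<close>.\<close>

lemma sum_D_summand_nonmult:
  "(\<Sum>j<n. \<Sum>i=1..p-1. D_summand r s (n * p) (j * p + i)) = 2 * (\<Sum>j<n. \<Sum>i=1..h. D_summand r s (n * p) (j * p + i))"
proof -
  let ?t = "D_summand r s (n * p)"
  have "?t (j * p + (p - i)) = ?t ((n - Suc j) * p + i)" if "j < n" "i \<le> h" for i j
  proof -
    have "Suc j * p \<le> n * p" using that by (intro mult_right_mono) auto
    then have "j * p + (p - i) \<le> n * p" "n * p - (j * p + (p - i)) = (n - Suc j) * p + i"
      using le_h_less_p[OF that(2)] by (simp_all add: diff_mult_distrib)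
    then show ?thesis using D_summand_sym by metis
  qed
  then have "(\<Sum>j<n. \<Sum>i=1..p-1. ?t (j * p + i)) =
    (\<Sum>j<n. \<Sum>i=1..h. ?t (j * p + i)) + (\<Sum>j<n. \<Sum>i=1..h. ?t ((n - Suc j) * p + i))"
    unfolding sum_reflect_p by (simp add: sum.distrib)
  also have "(\<Sum>j<n. \<Sum>i=1..h. ?t ((n - Suc j) * p + i)) = (\<Sum>j<n. \<Sum>i=1..h. ?t (j * p + i))"
    by (rule sum.nat_diff_reindex)
  finally show ?thesis by simp
qed

end

section \<open>The congruence\<close>

context rat_localization_ge5
begin

text \<open>The part common to both cases of \<open>calD\<close>.\<close>

definition calD_main :: "nat \<Rightarrow> nat \<Rightarrow> nat \<Rightarrow> rat" where
  "calD_main r s n = - 1 / 3 * (\<Sum>j=0..n. D_summand r s n j * of_nat (r * n * j * (n - j) + 2 * s * j ^ 3 + 2 * s * (n - j) ^ 3))"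

text \<open>The form in which indices prime to \<open>p\<close> contribute: 4 is the 2 of
  \<open>sum_D_summand_nonmult\<close> times the sign \<open>-1\<close> of the summands times the
  \<open>-2\<close> of \<open>half_cubes_cg\<close>.\<close>

definition domb_correction :: "nat \<Rightarrow> rat" where
  "domb_correction n = 4 * (\<Sum>j<n. of_nat (n choose j) ^ 2 * of_nat (n - j) ^ 3 * of_nat (cb j) * of_nat (cb (n - j)))"

lemma calD_eq:
  assumes "n \<ge> 1"
  shows "calD r s n = (if r = 2 \<and> s = 1 then domb_correction n else 0) + calD_main r s n"
proof -
  obtain m where m: "n = Suc m" using assms by (cases n) auto
  \<comment> \<open>With \<open>n = m + 1\<close>, the shifted central binomial coefficient in
    \<open>calD\<close> is \<open>cb (m - k)\<close>, and the range \<open>0..n-1\<close> becomes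
    \<open>k < n\<close>, as \<open>sum_domb_correction\<close> requires.\<close>
  have "2 * Suc m - 2 * k - 2 = 2 * (m - k)" "Suc m - k - 1 = m - k" for k by simp_all
  moreover have "{0..Suc m - 1} = {..<Suc m}" by auto
  ultimately have "domb_correction n = 8 * (\<Sum>k=0..n-1. of_nat ((n choose k)^2 * (2*k choose k) * (2*n-2*k-2 choose (n-k-1)) * n * (n-k)^2))"
    unfolding domb_correction_def m sum_domb_correction by (simp only: of_nat_mult of_nat_power)
  then show ?thesis unfolding calD_def calD_main_def D_summand_def
    by (simp add: right_diff_distrib' mult.assoc)
qed

lemma sum_D_summand_mult_cg:
  "cg 4 (\<Sum>j=0..n. D_summand r s (n * p) (j * p)) (of_nat (D r s n) + of_nat p ^ 3 * B * calD_main r s n)"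
proof -
  let ?q = "\<lambda>j. of_nat (r * n * j * (n - j) + 2 * s * j ^ 3 + 2 * s * (n - j) ^ 3) :: rat"
  have "cg 4 (\<Sum>j=0..n. D_summand r s (n * p) (j * p)) (\<Sum>j=0..n. D_summand r s n j * (1 + of_nat p ^ 3 * (- B / 3 * ?q j)))"
    by (intro cg_sum D_summand_mult_cg) simp
  also have "\<dots> = (\<Sum>j=0..n. D_summand r s n j + of_nat p ^ 3 * B * (- 1 / 3) * (D_summand r s n j * ?q j))"
    by (intro sum.cong refl) (simp only: distrib_left mult_1_right, simp)
  also have "\<dots> = of_nat (D r s n) + of_nat p ^ 3 * B * calD_main r s n"
    unfolding sum.distrib D_eq_sum_D_summand calD_main_def sum_distrib_left[symmetric] by (simp only: mult.assoc)
  finally show ?thesis .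
qed

text \<open>Each summand is \<open>p^3\<close> times a quantity needed only modulo \<open>p\<close>,
  namely \<open>- c j / i^3\<close>, so the double sum factors into the sum of the
  \<open>c j\<close> and \<open>T\<close>.\<close>

lemma sum_D_summand_nonmult_cg_domb:
  "cg 4 (\<Sum>j<n. \<Sum>i=1..p-1. D_summand 2 1 (n * p) (j * p + i)) (of_nat p ^ 3 * B * domb_correction n)"
proof -
  define c where "c j = of_nat (n choose j) ^ 2 * of_nat (n - j) ^ 3 * of_nat (cb j) * (of_nat (cb (n - j)) :: rat)" for j
  define T where "T = (\<Sum>i=1..h. 1 / of_nat i ^ 3 :: rat)"
  have iU: "of_nat i \<in> Up" if "1 \<le> i" "i \<le> h" for i
    using that le_h_less_p[of i] by (intro Up_of_nat_less) auto
  have summand: "cg 4 (D_summand 2 1 (n * p) (j * p + i)) (of_nat p ^ 3 * (- c j * (1 / of_nat i ^ 3)))"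
    if ji: "j < n" "1 \<le> i" "i \<le> h" for j i
  proof -
    obtain z y where zy: "D_summand 2 1 (n * p) (j * p + i) = of_nat p ^ (2 + 1) * (z ^ 2 * y ^ 1)"
      "z \<in> Zp" "y \<in> Zp" "cg 1 (z ^ 2) (of_nat (n choose j) ^ 2 * of_nat (n - j) ^ 2 / of_nat i ^ 2)"
      "cg 1 y (- of_nat (cb j) * of_nat (cb (n - j)) * of_nat (n - j) / of_nat i)"
      using D_summand_nonmult[OF ji, of 2 1] by blast
    have "cg 1 (z ^ 2 * y) ((of_nat (n choose j) ^ 2 * of_nat (n - j) ^ 2 / of_nat i ^ 2) *
        (- of_nat (cb j) * of_nat (cb (n - j)) * of_nat (n - j) / of_nat i))"
      using iU[OF ji(2,3)] by (intro cg_mult zy Zp_divide Zp_intros Up_power)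
    also have "\<dots> = - c j * (1 / of_nat i ^ 3)"
      unfolding c_def by (simp add: power2_eq_square power3_eq_cube mult_ac)
    finally have "cg (1 + 3) (of_nat p ^ 3 * (z ^ 2 * y)) (of_nat p ^ 3 * (- c j * (1 / of_nat i ^ 3)))"
      unfolding cg_p_mult .
    then show ?thesis unfolding zy(1) by simp
  qed
  have "(\<Sum>j<n. \<Sum>i=1..p-1. D_summand 2 1 (n * p) (j * p + i)) = 2 * (\<Sum>j<n. \<Sum>i=1..h. D_summand 2 1 (n * p) (j * p + i))"
    by (rule sum_D_summand_nonmult)
  also have "cg 4 \<dots> (2 * (\<Sum>j<n. \<Sum>i=1..h. of_nat p ^ 3 * (- c j * (1 / of_nat i ^ 3))))"
    by (rule cg_scale[OF cg_sum[OF cg_sum[OF summand]]]) auto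
  also have "\<dots> = of_nat p ^ 3 * (- 2 * (\<Sum>j<n. c j) * T)"
    unfolding T_def sum_distrib_left[symmetric] sum_distrib_right[symmetric] sum_negf by simp
  also have "cg 4 \<dots> (of_nat p ^ 3 * (- 2 * (\<Sum>j<n. c j) * (- 2 * B)))"
  proof -
    have "- 2 * (\<Sum>j<n. c j) \<in> Zp" unfolding c_def by (intro Zp_intros)
    then have "cg (1 + 3) (of_nat p ^ 3 * (- 2 * (\<Sum>j<n. c j) * T)) (of_nat p ^ 3 * (- 2 * (\<Sum>j<n. c j) * (- 2 * B)))"
      unfolding cg_p_mult T_def B_def by (intro cg_scale[OF half_cubes_cg])
    then show ?thesis by simp
  qed
  also have "\<dots> = of_nat p ^ 3 * B * domb_correction n"
    unfolding domb_correction_def c_def[symmetric] by simp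
  finally show ?thesis .
qed

lemma sum_D_summand_nonmult_cg:
  assumes "4 \<le> r + s"
  shows "cg 4 (\<Sum>j<n. \<Sum>i=1..p-1. D_summand r s (n * p) (j * p + i)) 0"
proof -
  have "cg 4 (D_summand r s (n * p) (j * p + i)) 0" if ji: "j < n" "1 \<le> i" "i \<le> h" for j i
  proof -
    obtain z y where zy: "D_summand r s (n * p) (j * p + i) = of_nat p ^ (r + s) * (z ^ r * y ^ s)" "z \<in> Zp" "y \<in> Zp"
      using D_summand_nonmult[OF ji, of r s] by blast
    have "of_nat p ^ (r + s) = (of_nat p ^ 4 * of_nat p ^ (r + s - 4) :: rat)"
      using assms by (simp flip: power_add)
    then show ?thesis unfolding zy(1)
      by (intro cgI[of "of_nat p ^ (r + s - 4) * (z ^ r * y ^ s)"]) (intro Zp_intros zy, simp)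
  qed
  then have "cg 4 (2 * (\<Sum>j<n. \<Sum>i=1..h. D_summand r s (n * p) (j * p + i))) (2 * (\<Sum>j<n. \<Sum>i=1..h. 0))"
    by (intro cg_scale[OF cg_sum] cg_sum) auto
  then show ?thesis unfolding sum_D_summand_nonmult by simp
qed

lemma D_mult_cg:
  assumes "r \<ge> 2" "s \<ge> 1" "n \<ge> 1"
  shows "cg 4 (of_nat (D r s (n * p))) (of_nat (D r s n) + of_nat p ^ 3 * B * calD r s n)"
proof -
  have "cg 4 (\<Sum>j<n. \<Sum>i=1..p-1. D_summand r s (n * p) (j * p + i))
      (of_nat p ^ 3 * B * (if r = 2 \<and> s = 1 then domb_correction n else 0))"
    using sum_D_summand_nonmult_cg_domb[of n] sum_D_summand_nonmult_cg[of r s n] assms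
    by (cases "r = 2 \<and> s = 1") (auto split: if_splits)
  from cg_add[OF sum_D_summand_mult_cg this]
  have "cg 4 (of_nat (D r s (n * p))) (of_nat (D r s n) + of_nat p ^ 3 * B * calD_main r s n +
      of_nat p ^ 3 * B * (if r = 2 \<and> s = 1 then domb_correction n else 0))"
    unfolding D_eq_sum_D_summand[of r s "n * p"] sum_blocks[OF p_pos(1)] .
  then show ?thesis unfolding calD_eq[OF assms(3)] by (simp only: distrib_left add_ac)
qed

end

theorem theorem2p1:
  fixes p r s n :: nat
  assumes "prime p" and "p \<ge> 5" and "r \<ge> 2" and "s \<ge> 1" and "n \<ge> 1"
  shows "rat_cong (of_nat (D r s (n * p)))
           (of_nat (D r s n) + of_nat p ^ 3 * bernoulli (p - 3) * calD r s n) p 4"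
proof -
  interpret rat_localization_ge5 p
    using assms(1,2) by unfold_locales
  show ?thesis using D_mult_cg[OF assms(3-5)] unfolding cg_def B_def .
qed

end
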